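(* For a positive integer $n$, let $\chi_{\max}(n)$ denote the maximum of the chromatic numbers $\chi(\mathrm{Cay}(G,S))$ as $S$ ranges over all sets of the form $S=\{\pm v_1,\dots,\pm v_n\}$, where $v_1,\dots,v_n$ are (not necessarily distinct) unit vectors in $\mathbb{R}^2$ and $G$ is the subgroup of $(\mathbb{R}^2,+)$ generated by $S$. Then $$\chi_{\max}(1)=\chi_{\max}(2)=2\quad\text{and}\quad \chi_{\max}(3)=\chi_{\max}(4)=3.$$
   Context: A subset $S$ of a group is symmetric if $x^{-1}\in S$ whenever $x\in S$. For a group $G$ with a symmetric subset $S$, the Cayley graph $\mathrm{Cay}(G,S)$ is the graph with vertex set $G$ in which $x$ and $y$ are adjacent if and only if $x^{-1}y\in S$; for $G$ a subgroup of $\mathbb{R}^2$ written additively, this means $y-x\in S$. Unit vectors are with respect to the Euclidean norm. A proper coloring of a graph assigns a color to each vertex so that adjacent vertices receive different colors; the chromatic number $\chi(X)$ of a graph $X$ is the smallest number of colors in a proper coloring. *)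

theory Defs
  imports
    "HOL-Analysis.Analysis"
    "HOL-Library.Extended_Nat"
    "HOL-Computational_Algebra.Group_Closure"
    "Graph_Theory.Pair_Digraph"
begin

text \<open>
  Graphs are rendered as (symmetric) pair digraphs: an edge between \<open>x\<close> and \<open>y\<close> is the pair of
  arcs \<open>(x, y)\<close> and \<open>(y, x)\<close>.
\<close>

definition proper_coloring :: "'a pair_pre_digraph \<Rightarrow> ('a \<Rightarrow> 'c) \<Rightarrow> bool" where
  "proper_coloring X c \<longleftrightarrow> (\<forall>(x, y) \<in> parcs X. c x \<noteq> c y)"

text \<open>
  The infimum in \<^typ>\<open>enat\<close> of a nonempty set is its least element. Graphs without a proper
  coloring by finitely many colors get the value \<open>\<infinity>\<close>.
\<close>

definition chromatic_number :: "'a pair_pre_digraph \<Rightarrow> enat" where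
  "chromatic_number X =
     Inf {enat k | k. \<exists>c. proper_coloring X c \<and> c ` pverts X \<subseteq> {..<k}}"

definition symmetric_subset :: "'a::group_add set \<Rightarrow> bool" where
  "symmetric_subset S \<longleftrightarrow> (\<forall>x\<in>S. - x \<in> S)"

text \<open>
  Groups are written additively, so \<open>- x + y\<close> stands for \<open>x\<^sup>-\<^sup>1y\<close>. The first argument is the
  carrier of a subgroup of the type; the second is meant to be a symmetric subset of it.
\<close>

definition Cay :: "'a::group_add set \<Rightarrow> 'a set \<Rightarrow> 'a pair_pre_digraph" where
  "Cay G S = \<lparr> pverts = G, parcs = {(x, y). x \<in> G \<and> y \<in> G \<and> - x + y \<in> S} \<rparr>"

definition pm_set :: "nat \<Rightarrow> (nat \<Rightarrow> 'a::group_add) \<Rightarrow> 'a set" where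
  "pm_set n v = (\<Union>i\<in>{1..n}. {v i, - v i})"

definition unit_cayley_chromatic_numbers :: "nat \<Rightarrow> enat set" where
  "unit_cayley_chromatic_numbers n =
     {chromatic_number (Cay (group_closure (pm_set n v)) (pm_set n v)) | v :: nat \<Rightarrow> real^2.
        \<forall>i\<in>{1..n}. norm (v i) = 1}"

definition chi_max :: "nat \<Rightarrow> enat" where
  "chi_max n = Max (unit_cayley_chromatic_numbers n)"

lemma symmetric_subset_pm_set: "symmetric_subset (pm_set n v)"
  by (auto simp: symmetric_subset_def pm_set_def)

lemma symmetric_Cay:
  assumes "symmetric_subset S"
  shows "symmetric (with_proj (Cay G S))"
proof -
  have "- y + x \<in> S" if "- x + y \<in> S" for x y
    using assms that by (metis symmetric_subset_def minus_add minus_minus)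
  then show ?thesis
    by (auto simp: symmetric_def Cay_def sym_def)
qed

text \<open>
  The maximum defining \<^const>\<open>chi_max\<close> exists: coloring \<open>x\<close> by the parities of
  \<open>\<lfloor>x \<bullet> v i\<rfloor>\<close>, \<open>i = 1, \<dots>, n\<close>, shows that all the chromatic numbers are at most \<open>2 ^ n\<close>.
\<close>

lemma chromatic_number_le:
  assumes "proper_coloring X c" "c ` pverts X \<subseteq> {..<k}"
  shows "chromatic_number X \<le> enat k"
  unfolding chromatic_number_def using assms by (intro Inf_lower) blast

lemma unit_cayley_chromatic_numbers_le:
  assumes "k \<in> unit_cayley_chromatic_numbers n"
  shows "k \<le> enat (2 ^ n)"
proof -
  obtain v :: "nat \<Rightarrow> real^2" where v: "\<forall>i\<in>{1..n}. norm (v i) = 1"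
    and k: "k = chromatic_number (Cay (group_closure (pm_set n v)) (pm_set n v))"
    using assms by (auto simp: unit_cayley_chromatic_numbers_def)
  define d where "d x = {i\<in>{1..n}. even \<lfloor>x \<bullet> v i\<rfloor>}" for x
  obtain e where e: "bij_betw e (Pow {1..n}) {0..<card (Pow {1..n})}"
    using ex_bij_betw_finite_nat[of "Pow {1..n}"] by auto
  have d_ne: "d x \<noteq> d (x + v i)" if "i \<in> {1..n}" for x i
  proof -
    have "v i \<bullet> v i = 1"
      using v that by (simp add: dot_square_norm)
    then have "\<lfloor>(x + v i) \<bullet> v i\<rfloor> = \<lfloor>x \<bullet> v i\<rfloor> + 1"
      by (simp add: inner_add_left)
    then have "i \<in> d x \<longleftrightarrow> i \<notin> d (x + v i)"
      using that by (simp add: d_def)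
    then show ?thesis by blast
  qed
  have "d x \<noteq> d y" if "- x + y \<in> pm_set n v" for x y
  proof -
    from that obtain i where i: "i \<in> {1..n}" "- x + y = v i \<or> - x + y = - v i"
      by (auto simp: pm_set_def)
    then have "y = x + v i \<or> x = y + v i"
      by (auto simp: algebra_simps)
    then show ?thesis using d_ne[OF i(1)] by metis
  qed
  moreover have "e (d x) = e (d y) \<longleftrightarrow> d x = d y" for x y
    by (rule inj_on_eq_iff[OF bij_betw_imp_inj_on[OF e]]) (auto simp: d_def)
  ultimately have "proper_coloring (Cay (group_closure (pm_set n v)) (pm_set n v)) (e \<circ> d)"
    by (auto simp: proper_coloring_def Cay_def)
  moreover have "(e \<circ> d) x < 2 ^ n" for x
    using bij_betwE[OF e] by (auto simp: d_def card_Pow)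
  ultimately show ?thesis
    unfolding k by (intro chromatic_number_le) auto
qed

lemma finite_unit_cayley_chromatic_numbers: "finite (unit_cayley_chromatic_numbers n)"
  using unit_cayley_chromatic_numbers_le by (rule finite_enat_bounded)

lemma unit_cayley_chromatic_numbers_nonempty: "unit_cayley_chromatic_numbers n \<noteq> {}"
proof -
  have "\<exists>v :: nat \<Rightarrow> real^2. \<forall>i\<in>{1..n}. norm (v i) = 1"
    by (rule exI[of _ "\<lambda>_. axis 1 1"]) simp
  then show ?thesis
    by (auto simp: unit_cayley_chromatic_numbers_def)
qed

end

theory Submission
  imports Defs
begin

text \<open>
  If an additive map \<open>\<phi>\<close> to the reals sends every generator into \<open>[1/3, 2/3] + \<int>\<close>, then \<open>\<lfloor>3 \<phi>(x)\<rfloor> mod 3\<close>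
  is a proper coloring; we find such a \<open>\<phi>\<close> for every set \<open>W\<close> of at most four unit vectors. Let \<open>B\<close> be a
  maximal subset of \<open>W\<close> that is independent over the rationals; on \<open>B\<close> the values of \<open>\<phi>\<close> can be
  prescribed. If \<open>W\<close> has at most one element outside \<open>B\<close>, there is a single relation to respect, which is easy.
  If \<open>B\<close> has one element, all vectors agree up to sign.

  In the remaining case \<open>B\<close> has two elements, and (unless \<open>W\<close> lies in \<open>\<plusminus> B\<close>) the Gram matrix is rational,
  so that we have at most four vectors of the same norm \<open>N\<close> for an integral binary quadratic form \<open>Q\<close>. Now look
  modulo 3. If 3 does not divide \<open>N\<close>, some linear form modulo 3 vanishes on none of the vectors, and a
  third of it serves as \<open>\<phi>\<close>. Otherwise, after dividing out common factors of \<open>Q\<close> and \<open>N\<close> and passing to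
  sublattices of index 3 as long as possible, \<open>Q\<close> is modulo 3 a product of two linear forms \<open>f\<close> and \<open>g\<close>,
  and every vector is a zero of \<open>f\<close> or of \<open>g\<close>. If none is a zero of both, take \<open>(f + g) / 3\<close>. If one is, few enough
  vectors remain that \<open>\<phi>\<close> can first be chosen on the zeros of \<open>f\<close> and \<open>g\<close>, and then be corrected on the others by
  adding multiples of \<open>f / 3\<close> and \<open>g / 3\<close>.

  An equilateral triangle gives the lower bound 3.
\<close>

section \<open>Real numbers within 1/6 of a half-integer \<open>k + 1/2\<close>\<close>

definition middle_third :: "real \<Rightarrow> bool" where
  "middle_third x \<longleftrightarrow> (\<exists>k::int. 1/3 \<le> x - of_int k \<and> x - of_int k \<le> 2/3)"

lemma middle_third_half: "middle_third (1/2)"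
  unfolding middle_third_def by (rule exI[of _ 0]) simp

lemma middle_third_add_int [simp]: "middle_third (x + of_int k) \<longleftrightarrow> middle_third x"
proof -
  have *: "middle_third (y + of_int j)" if "middle_third y" for y j
  proof -
    from that obtain i :: int where "1/3 \<le> y - of_int i" "y - of_int i \<le> 2/3"
      unfolding middle_third_def by blast
    then show ?thesis
      unfolding middle_third_def by (intro exI[of _ "i + j"]) simp
  qed
  from *[of x k] *[of "x + of_int k" "- k"] show ?thesis by auto
qed

lemma middle_third_uminus [simp]: "middle_third (- x) \<longleftrightarrow> middle_third x"
proof -
  have *: "middle_third (- y)" if "middle_third y" for y
  proof -
    from that obtain i :: int where "1/3 \<le> y - of_int i" "y - of_int i \<le> 2/3"
      unfolding middle_third_def by blast
    then show ?thesis
      unfolding middle_third_def by (intro exI[of _ "- i - 1"]) simp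
  qed
  from *[of x] *[of "- x"] show ?thesis by auto
qed

lemma middle_third_cong:
  assumes "x - y \<in> \<int>"
  shows "middle_third x \<longleftrightarrow> middle_third y"
proof -
  from assms obtain k where "x - y = of_int k" by (elim Ints_cases)
  then have "x = y + of_int k" by simp
  then show ?thesis by simp
qed

lemma middle_third_of_int_div_3:
  assumes "\<not> 3 dvd n"
  shows "middle_third (of_int n / 3)"
proof -
  from assms have "n = 3 * (n div 3) + 1 \<or> n = 3 * (n div 3) + 2" by presburger
  then obtain k where "n = 3 * k + 1 \<or> n = 3 * k + 2" by blast
  then show ?thesis
    unfolding middle_third_def by (intro exI[of _ k]) auto
qed

lemma dvd_3_square_minus_1: "3 dvd n * n - 1" if "\<not> 3 dvd n" for n :: int
proof -
  from that have "n = 3 * (n div 3) + 1 \<or> n = 3 * (n div 3) + 2" by presburger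
  then obtain k where "n = 3 * k + 1 \<or> n = 3 * k + 2" by blast
  then have "n * n - 1 = 3 * (3 * k * k + 2 * k) \<or> n * n - 1 = 3 * (3 * k * k + 4 * k + 1)"
    by (auto simp: algebra_simps)
  then show ?thesis by (metis dvd_triv_left)
qed

lemma of_int_div_3_in_Ints: "3 dvd n \<Longrightarrow> of_int n / 3 \<in> (\<int> :: real set)"
  by (auto elim!: dvdE)

text \<open>The interval \<open>[1/3, 2/3]\<close> has length 1/3, so some multiple of 1/3 moves
  \<open>x\<close> into it modulo 1. As \<open>n * n\<close> is 1 modulo 3, the multiples of
  \<open>n / 3\<close> reach all multiples of 1/3 modulo 1.\<close>

lemma middle_third_shift:
  assumes "\<not> 3 dvd n"
  obtains k :: int where "middle_third (x + of_int (k * n) / 3)"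
proof -
  define j where "j = 1 - \<lfloor>3 * x\<rfloor>"
  have "middle_third (x + of_int j / 3)"
    unfolding middle_third_def j_def
  proof (intro exI[of _ 0] conjI)
    have "of_int \<lfloor>3 * x\<rfloor> \<le> 3 * x" "3 * x < of_int \<lfloor>3 * x\<rfloor> + 1"
      by linarith+
    then show "1 / 3 \<le> x + of_int (1 - \<lfloor>3 * x\<rfloor>) / 3 - of_int 0"
      "x + of_int (1 - \<lfloor>3 * x\<rfloor>) / 3 - of_int 0 \<le> 2 / 3"
      by (simp_all add: field_simps)
  qed
  moreover have "(x + of_int (j * n * n) / 3) - (x + of_int j / 3) \<in> \<int>"
  proof -
    have "(x + of_int (j * n * n) / 3) - (x + of_int j / 3) = of_int (j * (n * n - 1)) / 3"
      by (simp add: field_simps)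
    moreover have "of_int (j * (n * n - 1)) / 3 \<in> (\<int> :: real set)"
      using dvd_3_square_minus_1[OF assms] by (intro of_int_div_3_in_Ints) simp
    ultimately show ?thesis by metis
  qed
  ultimately show thesis using that[of "j * n"] middle_third_cong by blast
qed

text \<open>For \<open>r = p / m\<close> in lowest terms, \<open>m y - p x\<close> sweeps out an interval of length
  \<open>(m + \<bar>p\<bar>) / 3 \<ge> 1\<close> when \<open>x\<close> and \<open>y\<close> vary over \<open>[1/3, 2/3]\<close>, so it meets \<open>m t + \<int>\<close>; moving \<open>x\<close>
  by integers then changes \<open>r x\<close> by arbitrary multiples of \<open>1 / m\<close> modulo 1.\<close>

lemma middle_third_rat_step:
  fixes r :: rat and t :: real
  assumes "r \<noteq> 0" "r \<noteq> 1" "r \<noteq> -1"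
  obtains x where "middle_third x" "middle_third (of_rat r * x + t)"
proof -
  obtain p m where pm: "quotient_of r = (p, m)" by (cases "quotient_of r")
  then have m: "m > 0" and cop: "coprime p m" and r: "r = of_int p / of_int m"
    using quotient_of_denom_pos quotient_of_coprime quotient_of_div by auto
  have p: "p \<noteq> 0" using assms r by auto
  have big: "\<bar>p\<bar> + m \<ge> 3"
  proof (rule ccontr)
    assume "\<not> ?thesis"
    then have "\<bar>p\<bar> = 1" "m = 1" using p m by linarith+
    then show False using r assms by (auto simp: abs_if split: if_splits)
  qed
  \<comment> \<open>The sign makes \<open>p * e = - \<bar>p\<bar>\<close>: when \<open>x\<close>
    runs from \<open>e / 3\<close> to \<open>2 * e / 3\<close> and \<open>y\<close> from 1/3 to 2/3,
    \<open>m * y - p * x\<close> grows by \<open>L\<close> in total.\<close>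
  define e :: real where "e = - of_int (sgn p)"
  define L :: real where "L = of_int m / 3 + of_int \<bar>p\<bar> / 3"
  have L: "L \<ge> 1"
    using big unfolding L_def by linarith
  define x0 y0 :: real where "x0 = e / 3" and "y0 = 1 / 3"
  define c where "c = of_int m * y0 - of_int p * x0 - of_int m * t"
  have abs_p: "of_int p * e = - (of_int \<bar>p\<bar> :: real)"
    unfolding e_def by (metis abs_sgn mult_minus_right of_int_mult)
  \<comment> \<open>The fraction of the run after which the quantity that starts at \<open>c\<close>
    reaches the next integer; it is at most 1 because \<open>L \<ge> 1\<close>.\<close>
  define l where "l = (of_int \<lceil>c\<rceil> - c) / L"
  have l: "0 \<le> l" "l \<le> 1"
  proof -
    show "0 \<le> l" unfolding l_def using L by simp
    have "of_int \<lceil>c\<rceil> - c \<le> 1" by linarith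
    then have "of_int \<lceil>c\<rceil> - c \<le> L" using L by linarith
    then show "l \<le> 1" unfolding l_def using L by simp
  qed
  define x y where "x = x0 + l * e / 3" and "y = y0 + l / 3"
  have e: "e = 1 \<or> e = -1" unfolding e_def using p by (auto simp: sgn_if)
  have y: "middle_third y"
    unfolding middle_third_def y_def y0_def using l by (intro exI[of _ 0]) simp
  have "middle_third ((1 + l) / 3)"
    unfolding middle_third_def using l by (intro exI[of _ 0]) simp
  then have x: "middle_third x"
    using e middle_third_uminus[of "(1 + l) / 3"]
    by (elim disjE) (simp_all add: x_def x0_def add_divide_distrib)
  have "of_int m * y - of_int p * x - of_int m * t
      = c + l * (of_int m / 3) - l * (of_int p * e) / 3"
    unfolding c_def x_def y_def by (simp add: algebra_simps)
  also have "\<dots> = c + l * L" unfolding abs_p L_def by (simp add: algebra_simps)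
  also have "\<dots> = of_int \<lceil>c\<rceil>" unfolding l_def using L by simp
  finally have j: "of_int p * x = of_int m * y - of_int m * t - of_int \<lceil>c\<rceil>" by simp
  obtain u v where uv: "u * p + v * m = 1"
    using bezout_int[of p m] cop by (auto simp: coprime_iff_gcd_eq_1)
  \<comment> \<open>Since \<open>u * p\<close> is 1 modulo \<open>m\<close>, moving \<open>x\<close>
    by \<open>n\<close> absorbs the integer \<open>\<lceil>c\<rceil>\<close> up to a multiple of
    \<open>m\<close>, which becomes an integer after division by \<open>m\<close>.\<close>
  define n where "n = u * \<lceil>c\<rceil>"
  have "p * n - \<lceil>c\<rceil> = - (v * m) * \<lceil>c\<rceil>"
    unfolding n_def using uv by algebra
  then have pn: "(of_int p * of_int n :: real) = of_int \<lceil>c\<rceil> - of_int v * of_int m * of_int \<lceil>c\<rceil>"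
    by (metis (no_types, lifting) add_diff_cancel_left' diff_add_cancel diff_minus_eq_add minus_mult_left of_int_diff of_int_minus of_int_mult uminus_add_conv_diff)
  have "of_int m * (of_rat r * (x + of_int n) + t) = of_int p * x + of_int p * of_int n + of_int m * t"
    using m by (simp add: r of_rat_divide field_simps)
  also have "\<dots> = of_int m * (y - of_int (v * \<lceil>c\<rceil>))"
    unfolding j pn by (simp add: algebra_simps)
  finally have "of_rat r * (x + of_int n) + t = y + of_int (- (v * \<lceil>c\<rceil>))"
    using m by simp
  then have "middle_third (of_rat r * (x + of_int n) + t)" using y by (metis middle_third_add_int)
  then show thesis using that[of "x + of_int n"] x by simp
qed

text \<open>Let \<open>r = p / q\<close> in lowest terms. If 3 divides \<open>p\<close>, then
  \<open>t = q / 3\<close> makes \<open>r * t\<close> an integer; otherwise \<open>t = c / 3\<close>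
  with \<open>c\<close> inverse to \<open>p\<close> modulo \<open>3 * q\<close> leaves an error of
  \<open>1 / (3 * q)\<close>.\<close>

lemma middle_third_rat_mult_near_Ints:
  fixes r :: rat
  obtains t d :: real and m :: int
  where "middle_third t" "of_rat r * t = of_int m + d" "\<bar>d\<bar> \<le> 1/3"
proof -
  obtain p q where pq: "quotient_of r = (p, q)" by (cases "quotient_of r")
  then have q: "q > 0" and cop: "coprime p q" and r: "r = of_int p / of_int q"
    using quotient_of_denom_pos quotient_of_coprime quotient_of_div by auto
  show thesis
  proof (cases "3 dvd p")
    case True
    then have "\<not> 3 dvd q" using cop by (metis coprime_common_divisor_int abs_numeral numeral_eq_one_iff semiring_norm(84))
    then have "middle_third (of_int q / 3)" by (rule middle_third_of_int_div_3)
    moreover from True obtain k where "p = 3 * k" ..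
    then have "of_rat r * (of_int q / 3) = of_int k + (0::real)"
      using q by (simp add: r of_rat_divide of_rat_mult)
    ultimately show thesis using that[of "of_int q / 3" k 0] by simp
  next
    case False
    have "coprime p 3"
      using False prime_imp_coprime[of 3 p] by (simp add: coprime_commute)
    then have "coprime p (3 * q)" using cop by simp
    then obtain c m where cm: "c * p + m * (3 * q) = 1"
      using bezout_int[of p "3 * q"] by (auto simp: coprime_iff_gcd_eq_1)
    have "\<not> 3 dvd c"
    proof
      assume "3 dvd c"
      then have "3 dvd c * p + m * (3 * q)" by simp
      then show False using cm by simp
    qed
    then have "middle_third (of_int c / 3)" by (rule middle_third_of_int_div_3)
    moreover have "of_rat r * (of_int c / 3) = of_int (- m) + 1 / (3 * of_int q :: real)"
    proof -
      from cm have "(of_int c * of_int p + of_int m * (3 * of_int q) :: real) = 1"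
        by (metis of_int_1 of_int_add of_int_mult of_int_numeral)
      then show ?thesis using q by (simp add: r of_rat_divide field_simps)
    qed
    moreover have "\<bar>1 / (3 * of_int q :: real)\<bar> \<le> 1/3"
      using q by (simp add: field_simps)
    ultimately show thesis by (rule that)
  qed
qed


section \<open>Integer vectors in the plane, linear and quadratic forms\<close>

lemma real_2x2_solvable:
  fixes a b c d :: int and r t :: real
  assumes "a * d - b * c \<noteq> 0"
  obtains s u where "of_int a * s + of_int b * u = r" "of_int c * s + of_int d * u = t"
proof -
  define D :: real where "D = of_int a * of_int d - of_int b * of_int c"
  have D: "D \<noteq> 0"
    unfolding D_def using assms by (metis of_int_diff of_int_eq_0_iff of_int_mult)
  define s u where "s = (r * of_int d - of_int b * t) / D" and "u = (of_int a * t - r * of_int c) / D"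
  have "of_int a * s + of_int b * u = (of_int a * (r * of_int d - of_int b * t) + of_int b * (of_int a * t - r * of_int c)) / D"
    "of_int c * s + of_int d * u = (of_int c * (r * of_int d - of_int b * t) + of_int d * (of_int a * t - r * of_int c)) / D"
    unfolding s_def u_def by (simp_all add: add_divide_distrib)
  moreover have "of_int a * (r * of_int d - of_int b * t) + of_int b * (of_int a * t - r * of_int c) = r * D"
    "of_int c * (r * of_int d - of_int b * t) + of_int d * (of_int a * t - r * of_int c) = t * D"
    by (simp_all add: D_def algebra_simps)
  ultimately show thesis using that D by simp
qed

text \<open>The components of \<open>p\<close> are the values of an additive map on the two basis
  vectors; \<open>v\<close> holds integer coordinates with respect to that basis.\<close>

definition pairing :: "real \<times> real \<Rightarrow> int \<times> int \<Rightarrow> real" where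
  "pairing p v = of_int (fst v) * fst p + of_int (snd v) * snd p"

definition lin_form :: "int \<times> int \<Rightarrow> int \<times> int \<Rightarrow> int" where
  "lin_form f v = fst f * fst v + snd f * snd v"

definition cross :: "int \<times> int \<Rightarrow> int \<times> int \<Rightarrow> int" where
  "cross v w = fst v * snd w - snd v * fst w"

definition quad_form :: "int \<Rightarrow> int \<Rightarrow> int \<Rightarrow> int \<times> int \<Rightarrow> int" where
  "quad_form A B C v = A * fst v * fst v + B * fst v * snd v + C * snd v * snd v"

definition third_colorable :: "(int \<times> int) set \<Rightarrow> bool" where
  "third_colorable V \<longleftrightarrow> (\<exists>p. \<forall>v\<in>V. middle_third (pairing p v))"

lemma ex_pairing:
  assumes "cross v w \<noteq> 0"
  obtains p where "pairing p v = r" "pairing p w = t"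
proof -
  obtain s u where "of_int (fst v) * s + of_int (snd v) * u = r"
      "of_int (fst w) * s + of_int (snd w) * u = t"
    using real_2x2_solvable[of "fst v" "snd w" "snd v" "fst w" r t] assms
    unfolding cross_def by blast
  then show thesis using that[of "(s, u)"] by (simp add: pairing_def)
qed

section \<open>Corrections by thirds of linear forms, for at most four vectors\<close>

definition shift_third :: "real \<times> real \<Rightarrow> int \<Rightarrow> int \<times> int \<Rightarrow> real \<times> real" where
  "shift_third p k f = (fst p + of_int (k * fst f) / 3, snd p + of_int (k * snd f) / 3)"

lemma pairing_shift_third:
  "pairing (shift_third p k f) v = pairing p v + of_int (k * lin_form f v) / 3"
  by (simp add: pairing_def shift_third_def lin_form_def field_simps)

lemma middle_third_shift_third:
  assumes "3 dvd lin_form f v"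
  shows "middle_third (pairing (shift_third p k f) v) \<longleftrightarrow> middle_third (pairing p v)"
proof (rule middle_third_cong)
  show "pairing (shift_third p k f) v - pairing p v \<in> \<int>"
    unfolding pairing_shift_third using of_int_div_3_in_Ints[of "k * lin_form f v"] assms by simp
qed

text \<open>Adding \<open>k * f / 3\<close> to the functional changes its values on \<open>V\<close>
  by integers only, while the value at \<open>w\<close> can be brought into the middle
  third.\<close>

lemma third_colorable_insert:
  assumes "third_colorable V" "\<And>v. v \<in> V \<Longrightarrow> 3 dvd lin_form f v" "\<not> 3 dvd lin_form f w"
  shows "third_colorable (insert w V)"
proof -
  obtain p where p: "\<forall>v\<in>V. middle_third (pairing p v)"
    using assms(1) unfolding third_colorable_def by blast
  obtain k where "middle_third (pairing p w + of_int (k * lin_form f w) / 3)"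
    using middle_third_shift[OF assms(3)] by blast
  then have "middle_third (pairing (shift_third p k f) w)"
    unfolding pairing_shift_third .
  moreover have "\<forall>v\<in>V. middle_third (pairing (shift_third p k f) v)"
    using p assms(2) by (simp add: middle_third_shift_third)
  ultimately have "\<forall>v\<in>insert w V. middle_third (pairing (shift_third p k f) v)" by simp
  then show ?thesis unfolding third_colorable_def by blast
qed

lemma third_colorable_if_lin_form:
  assumes "\<And>v. v \<in> V \<Longrightarrow> \<not> 3 dvd lin_form f v"
  shows "third_colorable V"
proof -
  have "pairing (of_int (fst f) / 3, of_int (snd f) / 3) v = of_int (lin_form f v) / 3" for v
    by (simp add: pairing_def lin_form_def field_simps)
  then show ?thesis
    unfolding third_colorable_def using assms middle_third_of_int_div_3 by metis
qed

lemma third_colorable_singleton: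
  assumes "v \<noteq> (0, 0)"
  shows "third_colorable {v}"
proof -
  have "cross v (- snd v, fst v) \<noteq> 0"
    using assms by (auto simp: cross_def prod_eq_iff add_eq_0_iff) (metis sum_squares_eq_zero_iff add.commute add_eq_0_iff mult.commute)+
  then obtain p where "pairing p v = 1/2" using ex_pairing[of v _ "1/2" 0] by blast
  then show ?thesis
    unfolding third_colorable_def by (metis middle_third_half singletonD)
qed

lemma parallel_same_norm:
  assumes "cross v w = 0" "quad_form A B C v = N" "quad_form A B C w = N" "N \<noteq> 0"
  shows "w = v \<or> w = (- fst v, - snd v)"
proof -
  obtain a b c d where vw: "v = (a, b)" "w = (c, d)" by (cases v, cases w)
  have cr: "a * d = b * c" using assms(1) by (simp add: cross_def vw)
  have q: "A*a*a + B*a*b + C*b*b = N" "A*c*c + B*c*d + C*d*d = N"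
    using assms(2,3) by (simp_all add: quad_form_def vw)
  \<comment> \<open>By \<open>cr\<close>, \<open>a\<close> times \<open>w\<close> is
    \<open>c\<close> times \<open>v\<close>, and \<open>b\<close> times \<open>w\<close> is
    \<open>d\<close> times \<open>v\<close>; the quadratic form is applied to both
    equations.\<close>
  have "a*a*N = c*c*N" "b*b*N = d*d*N" 
    using cr q by algebra+
  then have "a*a = c*c" "b*b = d*d" using assms(4) by simp_all
  then have ac: "c = a \<or> c = - a" and bd: "d = b \<or> d = - b"
    by (metis square_eq_iff)+
  from ac bd cr show ?thesis
    by (auto simp: vw)
qed

lemma third_colorable_pair:
  assumes "quad_form A B C v = N" "quad_form A B C w = N" "N \<noteq> 0"
  shows "third_colorable {v, w}"
proof (cases "cross v w = 0")
  case True
  have "v \<noteq> (0, 0)" using assms by (auto simp: quad_form_def)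
  then obtain p where p: "middle_third (pairing p v)"
    using third_colorable_singleton unfolding third_colorable_def by blast
  have "pairing p (- fst v, - snd v) = - pairing p v" by (simp add: pairing_def)
  then have "middle_third (pairing p w)"
    using parallel_same_norm[OF True assms] p by (metis middle_third_uminus)
  then show ?thesis using p unfolding third_colorable_def by blast
next
  case False
  then obtain p where "pairing p v = 1/2" "pairing p w = 1/2" by (rule ex_pairing)
  then show ?thesis
    unfolding third_colorable_def by (metis middle_third_half insertE singletonD)
qed

lemma pairing_lin_comb:
  "pairing p (fst v + e * fst w, snd v + e * snd w) = pairing p v + of_int e * pairing p w"
  by (simp add: pairing_def algebra_simps)

lemma cross_eq_0_imp_multiple:
  assumes "cross w h = 0" "w \<noteq> (0, 0)"
  obtains r :: rat where "\<And>p. pairing p h = of_rat r * pairing p w"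
proof -
  obtain a b c d where wh: "w = (a, b)" "h = (c, d)" by (cases w, cases h)
  have "of_int a * of_int d = (of_int b * of_int c :: real)"
    using assms(1) unfolding wh cross_def by (metis eq_iff_diff_eq_0 fst_conv of_int_mult snd_conv)
  moreover have "a \<noteq> 0 \<or> b \<noteq> 0" using assms(2) wh by simp
  ultimately have "pairing p h = of_rat (if a \<noteq> 0 then of_int c / of_int a else of_int d / of_int b) * pairing p w" for p
    by (auto simp: pairing_def wh of_rat_divide field_simps)
  then show thesis by (rule that)
qed

text \<open>Here \<open>third_colorable_insert\<close> does not suffice: a single form has to
  correct two vectors at once.\<close>

lemma third_colorable_triple:
  assumes f: "\<not> 3 dvd lin_form f v" "\<not> 3 dvd lin_form f w" "3 dvd lin_form f z"
    and Q: "quad_form A B C v = N" "quad_form A B C z = N" "N \<noteq> 0"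
  shows "third_colorable {v, w, z}"
proof -
  have z: "z \<noteq> (0, 0)" using Q by (auto simp: quad_form_def)
  have "3 dvd lin_form f v - lin_form f w \<or> 3 dvd lin_form f v + lin_form f w"
    using f by presburger
  then obtain e :: int where e: "e = 1 \<or> e = -1" and ef: "3 dvd lin_form f v + e * lin_form f w"
    by (metis mult_1 mult_minus1 diff_conv_add_uminus)
  \<comment> \<open>If \<open>p\<close> maps \<open>h\<close> to within 1/3 of an integer, it takes nearly opposite values on \<open>v\<close> and \<open>e w\<close>
    modulo 1, so that one correction moves both into the middle third.\<close>
  define h where "h = (fst v + e * fst w, snd v + e * snd w)"
  have ph: "pairing p h = pairing p v + of_int e * pairing p w" for p
    unfolding h_def by (rule pairing_lin_comb)
  have ew: "middle_third (of_int e * x) \<longleftrightarrow> middle_third x" for x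
    using e by auto
  show ?thesis
  proof (cases "cross z h = 0")
    case False
    \<comment> \<open>With value 0 at \<open>h\<close>, the vectors \<open>v\<close> and
      \<open>- e w\<close> have equal values, and these stay equal modulo 1 under every shift by
      thirds of \<open>f\<close>.\<close>
    then obtain p where p: "pairing p z = 1/2" "pairing p h = 0" by (rule ex_pairing)
    obtain k where k: "middle_third (pairing p v + of_int (k * lin_form f v) / 3)"
      using middle_third_shift[OF f(1)] by blast
    define p' where "p' = shift_third p k f"
    have v: "middle_third (pairing p' v)"
      using k by (simp add: p'_def pairing_shift_third)
    have "- (of_int e * pairing p' w) - pairing p' v = - (of_int (k * (lin_form f v + e * lin_form f w)) / 3)"
      using p(2) by (simp add: p'_def ph pairing_shift_third field_simps)
    moreover have "of_int (k * (lin_form f v + e * lin_form f w)) / 3 \<in> (\<int> :: real set)"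
      using ef by (intro of_int_div_3_in_Ints) simp
    ultimately have "middle_third (- (of_int e * pairing p' w)) \<longleftrightarrow> middle_third (pairing p' v)"
      by (intro middle_third_cong) (metis Ints_minus)
    then have "middle_third (pairing p' w)"
      using v ew by simp
    moreover have "middle_third (pairing p' z)"
      unfolding p'_def middle_third_shift_third[OF f(3)] p(1) by (rule middle_third_half)
    ultimately show ?thesis using v unfolding third_colorable_def by blast
  next
    case True
    then obtain r :: rat where r: "\<And>p. pairing p h = of_rat r * pairing p z"
      using z by (rule cross_eq_0_imp_multiple) blast
    \<comment> \<open>Now the value at \<open>z\<close> determines the one at \<open>h\<close>. It
      is chosen to make the latter \<open>m + d\<close>, and \<open>d\<close> is split evenly:
      \<open>v\<close> gets \<open>1/2 + d/2\<close> and \<open>e w\<close> gets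
      \<open>m - (1/2 - d/2)\<close>, both off a half-integer by at most 1/6.\<close>
    obtain t d m where t: "middle_third t" "of_rat r * t = of_int m + d" "\<bar>d\<bar> \<le> 1/3"
      by (rule middle_third_rat_mult_near_Ints)
    have "cross v z \<noteq> 0"
    proof
      assume "cross v z = 0"
      then have "z = v \<or> z = (- fst v, - snd v)" using Q by (rule parallel_same_norm)
      then have "lin_form f z = lin_form f v \<or> lin_form f z = - lin_form f v"
        by (auto simp: lin_form_def)
      then show False using f by auto
    qed
    then obtain p where p: "pairing p v = 1/2 + d/2" "pairing p z = t" by (rule ex_pairing)
    have "1/3 \<le> 1/2 + d/2" "1/2 + d/2 \<le> 2/3" "1/3 \<le> 1/2 - d/2" "1/2 - d/2 \<le> 2/3"
      using t(3) by linarith+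
    then have "middle_third (1/2 + d/2)" "middle_third (1/2 - d/2)"
      unfolding middle_third_def by (metis diff_zero of_int_0)+
    moreover have "of_int e * pairing p w = - (1/2 - d/2) + of_int m"
    proof -
      have "pairing p v + of_int e * pairing p w = of_int m + d"
        using t(2) ph[of p] r[of p] p(2) by simp
      then show ?thesis using p(1) by simp
    qed
    ultimately have "middle_third (pairing p w)" "middle_third (pairing p v)"
      using p(1) ew[of "pairing p w"] by (metis middle_third_add_int middle_third_uminus)+
    then show ?thesis using p(2) t(1) unfolding third_colorable_def by blast
  qed
qed

text \<open>A third vector \<open>x\<close> is either a zero of \<open>f\<close> modulo 3, in which
  case \<open>{x, z}\<close> is treated first and \<open>w\<close> is corrected, or a nonzero like
  \<open>w\<close>, which is the situation of \<open>third_colorable_triple\<close>.\<close>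

lemma third_colorable_card_le_3:
  assumes fin: "finite V" "card V \<le> 3"
    and Q: "\<And>v. v \<in> V \<Longrightarrow> quad_form A B C v = N" "N \<noteq> 0"
    and f: "w \<in> V" "\<not> 3 dvd lin_form f w" "z \<in> V" "3 dvd lin_form f z"
  shows "third_colorable V"
proof -
  have "w \<noteq> z" using f by auto
  have "card (V - {w, z}) \<le> 1"
    using fin f \<open>w \<noteq> z\<close> by (subst card_Diff_subset) auto
  then have "card (V - {w, z}) = 0 \<or> card (V - {w, z}) = 1" by linarith
  then consider "V - {w, z} = {}" | x where "V - {w, z} = {x}"
    using fin by (auto simp: card_1_singleton_iff)
  then consider "V = {w, z}" | x where "V = {x, w, z}"
    using f by cases blast+
  then show ?thesis
  proof cases
    case 1
    then show ?thesis using third_colorable_pair[of A B C w N z] Q f by simp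
  next
    case 2
    show ?thesis
    proof (cases "3 dvd lin_form f x")
      case True
      have "third_colorable {x, z}" using 2 Q f by (intro third_colorable_pair[of A B C _ N]) auto
      then have "third_colorable (insert w {x, z})"
        by (rule third_colorable_insert[where f = f]) (use True f in auto)
      then show ?thesis using 2 by (simp add: insert_commute)
    next
      case False
      then show ?thesis using 2 Q f third_colorable_triple[of f x w z A B C N] by auto
    qed
  qed
qed

text \<open>The vector \<open>b\<close> is treated last: multiples of \<open>g / 3\<close> move its
  value without disturbing the others modulo 1.\<close>

lemma third_colorable_if_unique:
  assumes fin: "finite V" "card V \<le> 4"
    and Q: "\<And>v. v \<in> V \<Longrightarrow> quad_form A B C v = N" "N \<noteq> 0"
    and f: "a \<in> V" "\<not> 3 dvd lin_form f a" "z \<in> V" "3 dvd lin_form f z"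
    and b: "b \<in> V" "\<not> 3 dvd lin_form g b" "b \<noteq> a" "b \<noteq> z"
    and unique: "\<And>v. v \<in> V \<Longrightarrow> v \<noteq> b \<Longrightarrow> 3 dvd lin_form g v"
  shows "third_colorable V"
proof -
  have "third_colorable (V - {b})"
    using fin Q f b by (intro third_colorable_card_le_3[of _ A B C N a f z]) auto
  then have "third_colorable (insert b (V - {b}))"
    using unique b by (intro third_colorable_insert[where f = g]) auto
  then show ?thesis using b by (simp add: insert_absorb)
qed

text \<open>If \<open>z\<close> is a common zero, the nonzeros of \<open>f\<close> and those of
  \<open>g\<close> form disjoint nonempty sets that avoid \<open>z\<close>. They have at most three
  elements together, so one of them is a singleton and \<open>third_colorable_if_unique\<close>
  applies.\<close>

lemma third_colorable_two_forms:
  assumes fin: "finite V" "card V \<le> 4"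
    and Q: "\<And>v. v \<in> V \<Longrightarrow> quad_form A B C v = N" "N \<noteq> 0"
    and fg: "\<And>v. v \<in> V \<Longrightarrow> 3 dvd lin_form f v \<or> 3 dvd lin_form g v"
    and f: "a \<in> V" "\<not> 3 dvd lin_form f a"
    and g: "b \<in> V" "\<not> 3 dvd lin_form g b"
  shows "third_colorable V"
proof (cases "\<exists>z\<in>V. 3 dvd lin_form f z \<and> 3 dvd lin_form g z")
  case False
  have "\<not> 3 dvd lin_form (fst f + fst g, snd f + snd g) v" if "v \<in> V" for v
  proof -
    have "lin_form (fst f + fst g, snd f + snd g) v = lin_form f v + lin_form g v"
      by (simp add: lin_form_def algebra_simps)
    moreover have "3 dvd lin_form f v \<and> \<not> 3 dvd lin_form g v \<or> \<not> 3 dvd lin_form f v \<and> 3 dvd lin_form g v"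
      using False fg that by blast
    ultimately show ?thesis by (metis dvd_add_left_iff dvd_add_right_iff)
  qed
  then show ?thesis by (rule third_colorable_if_lin_form)
next
  case True
  then obtain z where z: "z \<in> V" "3 dvd lin_form f z" "3 dvd lin_form g z" by blast
  define F G where "F = {v \<in> V. \<not> 3 dvd lin_form f v}" and "G = {v \<in> V. \<not> 3 dvd lin_form g v}"
  have [simp]: "finite F" "finite G" using fin by (simp_all add: F_def G_def)
  have "F \<inter> G = {}" using fg by (auto simp: F_def G_def)
  moreover have "F \<union> G \<subseteq> V - {z}" using z by (auto simp: F_def G_def)
  then have "card (F \<union> G) \<le> card (V - {z})" using fin by (intro card_mono) auto
  ultimately have "card F + card G \<le> 3" using fin z by (simp add: card_Un_disjoint)
  moreover have "a \<in> F" "b \<in> G" using f g by (simp_all add: F_def G_def)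
  then have "card F \<noteq> 0" "card G \<noteq> 0" by auto
  ultimately consider "card F = 1" | "card G = 1" by linarith
  moreover have "a \<noteq> b" using fg f g by blast
  ultimately show ?thesis
  proof cases
    case 1
    moreover have "a \<in> F" using f by (simp add: F_def)
    ultimately have "F = {a}" by (metis card_1_singletonE singletonD)
    then have "\<And>v. v \<in> V \<Longrightarrow> v \<noteq> a \<Longrightarrow> 3 dvd lin_form f v" by (auto simp: F_def)
    then show ?thesis
      using fin Q f g fg z \<open>a \<noteq> b\<close> by (intro third_colorable_if_unique[of V A B C N b g z a f]) auto
  next
    case 2
    moreover have "b \<in> G" using g by (simp add: G_def)
    ultimately have "G = {b}" by (metis card_1_singletonE singletonD)
    then have "\<And>v. v \<in> V \<Longrightarrow> v \<noteq> b \<Longrightarrow> 3 dvd lin_form g v" by (auto simp: G_def)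
    then show ?thesis
      using fin Q f g fg z \<open>a \<noteq> b\<close> by (intro third_colorable_if_unique[of V A B C N a f z b g]) auto
  qed
qed

section \<open>Quadratic forms modulo 3 and the descent\<close>

text \<open>Modulo 3 the values of the form on \<open>(1, 0)\<close>, \<open>(0, 1)\<close>, \<open>(1, 1)\<close>, \<open>(1, -1)\<close> add up to 0, so they are not
  all equal to \<open>N\<close>; on the line where the value differs from \<open>N\<close> there is no vector of norm \<open>N\<close>.\<close>

lemma lin_form_nonvanishing_mod_3:
  assumes "\<not> 3 dvd N"
  obtains f where "\<And>v. quad_form A B C v = N \<Longrightarrow> \<not> 3 dvd lin_form f v"
proof -
  \<comment> \<open>On a line modulo 3 the form is \<open>c * (x * x)\<close>, where
    \<open>c\<close> is its value at a generator. If this is \<open>N\<close> modulo 3, then 3 does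
    not divide \<open>x\<close>, so \<open>x * x\<close> is 1 and \<open>c\<close> is
    \<open>N\<close> modulo 3.\<close>
  have sq: "3 dvd N - c" if "3 dvd N - c * (x * x)" for c x :: int
  proof -
    have "\<not> 3 dvd x" 
    proof
      assume "3 dvd x"
      then have "3 dvd c * (x * x)" by simp
      with that have "3 dvd (N - c * (x * x)) + c * (x * x)" by (rule dvd_add)
      then have "3 dvd N" by simp
      with assms show False ..
    qed
    then have "3 dvd c * (x * x - 1)" using dvd_3_square_minus_1 by simp
    with that have "3 dvd (N - c * (x * x)) + c * (x * x - 1)" by (rule dvd_add)
    then show ?thesis by (simp add: algebra_simps)
  qed
  have "\<not> (3 dvd N - A \<and> 3 dvd N - C \<and> 3 dvd N - (A + B + C) \<and> 3 dvd N - (A - B + C))"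
  proof
    assume *: "3 dvd N - A \<and> 3 dvd N - C \<and> 3 dvd N - (A + B + C) \<and> 3 dvd N - (A - B + C)"
    then have "3 dvd ((N - A) + (N - C)) + ((N - (A + B + C)) + (N - (A - B + C)))"
      by (intro dvd_add) auto
    also have "\<dots> = N + 3 * (N - A - C)" by (simp add: algebra_simps)
    finally show False using assms by (metis dvd_add_left_iff dvd_triv_left)
  qed
  then consider "\<not> 3 dvd N - A" | "\<not> 3 dvd N - C" | "\<not> 3 dvd N - (A + B + C)" | "\<not> 3 dvd N - (A - B + C)"
    by blast
  then show thesis
  proof cases
    case 1
    have "\<not> 3 dvd lin_form (0, 1) v" if "quad_form A B C v = N" for v
    proof
      assume "3 dvd lin_form (0, 1) v"
      then obtain k where "snd v = 3 * k" by (auto simp: lin_form_def elim: dvdE)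
      with that have "N - A * (fst v * fst v) = 3 * (B * fst v * k + 3 * C * k * k)"
        by (auto simp: quad_form_def algebra_simps)
      then show False using 1 sq by (metis dvd_triv_left)
    qed
    then show thesis by (rule that)
  next
    case 2
    have "\<not> 3 dvd lin_form (1, 0) v" if "quad_form A B C v = N" for v
    proof
      assume "3 dvd lin_form (1, 0) v"
      then obtain k where "fst v = 3 * k" by (auto simp: lin_form_def elim: dvdE)
      with that have "N - C * (snd v * snd v) = 3 * (B * snd v * k + 3 * A * k * k)"
        by (auto simp: quad_form_def algebra_simps)
      then show False using 2 sq by (metis dvd_triv_left)
    qed
    then show thesis by (rule that)
  next
    case 3
    have "\<not> 3 dvd lin_form (1, -1) v" if "quad_form A B C v = N" for v
    proof
      assume "3 dvd lin_form (1, -1) v"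
      then obtain k where "fst v - snd v = 3 * k" by (auto simp: lin_form_def elim: dvdE)
      then have "fst v = snd v + 3 * k" by simp
      with that have "N - (A + B + C) * (snd v * snd v) = 3 * (B * snd v * k + 2 * A * snd v * k + 3 * A * k * k)"
        by (auto simp: quad_form_def algebra_simps)
      then show False using 3 sq by (metis dvd_triv_left)
    qed
    then show thesis by (rule that)
  next
    case 4
    have "\<not> 3 dvd lin_form (1, 1) v" if "quad_form A B C v = N" for v
    proof
      assume "3 dvd lin_form (1, 1) v"
      then obtain k where "fst v + snd v = 3 * k" by (auto simp: lin_form_def elim: dvdE)
      then have "fst v = 3 * k - snd v" by simp
      with that have "N - (A - B + C) * (snd v * snd v) = 3 * (B * snd v * k - 2 * A * snd v * k + 3 * A * k * k)"
        by (auto simp: quad_form_def algebra_simps)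
      then show False using 4 sq by (metis dvd_triv_left)
    qed
    then show thesis by (rule that)
  qed
qed

lemma quad_form_mod_3_factors:
  assumes "\<not> (3 dvd A \<and> 3 dvd B \<and> 3 dvd C)"
  obtains f g where "\<not> (3 dvd fst f \<and> 3 dvd snd f)" "\<not> (3 dvd fst g \<and> 3 dvd snd g)"
    "\<And>v. 3 dvd quad_form A B C v \<Longrightarrow> 3 dvd lin_form f v \<or> 3 dvd lin_form g v"
proof (cases "3 dvd A")
  case True
  have "3 dvd lin_form (0, 1) v \<or> 3 dvd lin_form (B, C) v" if "3 dvd quad_form A B C v" for v
  proof -
    have "quad_form A B C v = A * (fst v * fst v) + snd v * lin_form (B, C) v"
      by (simp add: quad_form_def lin_form_def algebra_simps)
    with that True have "3 dvd snd v * lin_form (B, C) v" by (metis dvd_add_right_iff dvd_mult2)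
    then show ?thesis by (auto simp: prime_dvd_mult_iff lin_form_def)
  qed
  then show thesis using that[of "(0, 1)" "(B, C)"] True assms by auto
next
  case False
  \<comment> \<open>Complete the square: whether the form has linear factors modulo 3 depends on the discriminant.\<close>
  define D where "D = B * B - 4 * A * C"
  have sq: "3 dvd (2 * A * fst v + B * snd v) * (2 * A * fst v + B * snd v) - D * (snd v * snd v)"
    if "3 dvd quad_form A B C v" for v
  proof -
    have "(2 * A * fst v + B * snd v) * (2 * A * fst v + B * snd v) - D * (snd v * snd v) = 4 * A * quad_form A B C v"
      by (simp add: D_def quad_form_def algebra_simps)
    then show ?thesis using that by simp
  qed
  have A2: "\<not> 3 dvd 2 * A" using False by presburger
  have "3 dvd D \<or> 3 dvd D - 1 \<or> 3 dvd D + 1" by presburger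
  then consider "3 dvd D" | "3 dvd D - 1" | "3 dvd D + 1" by blast
  then show thesis
  proof cases
    case 1
    have "3 dvd lin_form (2 * A, B) v" if "3 dvd quad_form A B C v" for v
    proof -
      have "3 dvd (2 * A * fst v + B * snd v) * (2 * A * fst v + B * snd v)"
        using sq[OF that] 1 by (metis dvd_mult2 dvd_diff_left_iff)
      then show ?thesis by (auto simp: prime_dvd_mult_iff lin_form_def)
    qed
    then show thesis using that[of "(2 * A, B)" "(2 * A, B)"] A2 by auto
  next
    case 2
    have "3 dvd lin_form (2 * A, B - 1) v \<or> 3 dvd lin_form (2 * A, B + 1) v" if "3 dvd quad_form A B C v" for v
    proof -
      have "lin_form (2 * A, B - 1) v * lin_form (2 * A, B + 1) v =
          ((2 * A * fst v + B * snd v) * (2 * A * fst v + B * snd v) - D * (snd v * snd v)) + (D - 1) * (snd v * snd v)"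
        by (simp add: lin_form_def algebra_simps)
      then have "3 dvd lin_form (2 * A, B - 1) v * lin_form (2 * A, B + 1) v"
        using sq[OF that] 2 by (metis dvd_add dvd_mult2)
      then show ?thesis by (simp add: prime_dvd_mult_iff)
    qed
    then show thesis using that[of "(2 * A, B - 1)" "(2 * A, B + 1)"] A2 by auto
  next
    case 3
    \<comment> \<open>Otherwise the completed square gives \<open>x * x = -1\<close> modulo 3, but
      -1 is not a square there.\<close>
    have "3 dvd lin_form (0, 1) v" if "3 dvd quad_form A B C v" for v
    proof (rule ccontr)
      define x where "x = 2 * A * fst v + B * snd v"
      assume "\<not> 3 dvd lin_form (0, 1) v"
      then have y: "3 dvd snd v * snd v - 1" by (intro dvd_3_square_minus_1) (simp add: lin_form_def)
      have "3 dvd x * x - D * (snd v * snd v)" using sq[OF that] by (simp add: x_def)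
      moreover have "3 dvd (D + 1) * (snd v * snd v)" using 3 by simp
      ultimately have "3 dvd (x * x - D * (snd v * snd v)) + (D + 1) * (snd v * snd v) - (snd v * snd v - 1)"
        using y dvd_add dvd_diff by blast
      then have "3 dvd x * x + 1" by (simp add: algebra_simps)
      moreover have "3 dvd x * x \<or> 3 dvd x * x - 1"
        using dvd_3_square_minus_1[of x] dvd_mult by blast
      ultimately show False by presburger
    qed
    then show thesis using that[of "(0, 1)" "(0, 1)"] by auto
  qed
qed

text \<open>Coordinates with respect to a basis of the index-3 sublattice of all vectors on which the
  form vanishes modulo 3.\<close>

lemma sublattice_coordinates:
  assumes f: "\<not> (3 dvd fst f \<and> 3 dvd snd f)"
  obtains T A' B' C' where
    "\<And>v. 3 dvd lin_form f v \<Longrightarrow> quad_form A' B' C' (T v) = quad_form A B C v"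
    "\<And>v w. 3 dvd lin_form f v \<Longrightarrow> 3 dvd lin_form f w \<Longrightarrow> cross v w = 3 * cross (T v) (T w)"
    "\<And>V. (\<And>v. v \<in> V \<Longrightarrow> 3 dvd lin_form f v) \<Longrightarrow> third_colorable (T ` V) \<Longrightarrow> third_colorable V"
proof (cases "3 dvd fst f")
  case True
  then have "\<not> 3 dvd snd f" using f by blast
  have y: "\<exists>k. snd v = 3 * k" if "3 dvd lin_form f v" for v
  proof -
    have "3 dvd snd f * snd v"
      using that True unfolding lin_form_def by (metis dvd_add_right_iff dvd_mult2)
    then have "3 dvd snd v" using \<open>\<not> 3 dvd snd f\<close> by (simp add: prime_dvd_mult_iff)
    then show ?thesis by (auto elim: dvdE)
  qed
  define T :: "int \<times> int \<Rightarrow> int \<times> int" where "T v = (fst v, snd v div 3)" for v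
  show thesis
  proof (rule that[of A "3 * B" "9 * C" T])
    fix v assume "3 dvd lin_form f v"
    from y[OF this] obtain k where "snd v = 3 * k" ..
    then show "quad_form A (3 * B) (9 * C) (T v) = quad_form A B C v"
      by (simp add: T_def quad_form_def)
  next
    fix v w assume "3 dvd lin_form f v" "3 dvd lin_form f w"
    from y[OF this(1)] y[OF this(2)] obtain k l where "snd v = 3 * k" "snd w = 3 * l" by blast
    then show "cross v w = 3 * cross (T v) (T w)"
      by (simp add: T_def cross_def)
  next
    fix V assume V: "\<And>v. v \<in> V \<Longrightarrow> 3 dvd lin_form f v" and "third_colorable (T ` V)"
    then obtain p where p: "\<forall>v\<in>V. middle_third (pairing p (T v))"
      unfolding third_colorable_def by blast
    have "pairing (fst p, snd p / 3) v = pairing p (T v)" if v: "v \<in> V" for v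
    proof -
      from y[OF V[OF v]] obtain k where "snd v = 3 * k" ..
      then show ?thesis by (simp add: T_def pairing_def)
    qed
    then show "third_colorable V" unfolding third_colorable_def using p by metis
  qed
next
  case False
  \<comment> \<open>As \<open>fst f\<close> is its own inverse modulo 3, \<open>c\<close> is the
    quotient of \<open>snd f\<close> by \<open>fst f\<close>, and the zeros of \<open>f\<close>
    satisfy \<open>fst v + c * snd v = 0\<close> modulo 3. The basis behind \<open>T\<close> is
    \<open>(3, 0)\<close>, \<open>(- c, 1)\<close>.\<close>
  define c where "c = fst f * snd f"
  have x: "\<exists>k. fst v = 3 * k - c * snd v" if "3 dvd lin_form f v" for v
  proof -
    have "3 dvd fst f * lin_form f v - (fst f * fst f - 1) * fst v"
      using that dvd_3_square_minus_1[OF False] by (intro dvd_diff) auto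
    also have "fst f * lin_form f v - (fst f * fst f - 1) * fst v = fst v + c * snd v"
      by (simp add: lin_form_def c_def algebra_simps)
    finally obtain k where "fst v + c * snd v = 3 * k" by (elim dvdE)
    then have "fst v = 3 * k - c * snd v" by simp
    then show ?thesis ..
  qed
  define T :: "int \<times> int \<Rightarrow> int \<times> int" where "T v = ((fst v + c * snd v) div 3, snd v)" for v
  show thesis
  proof (rule that[of "9 * A" "3 * B - 6 * A * c" "A * c * c - B * c + C" T])
    fix v assume "3 dvd lin_form f v"
    from x[OF this] obtain k where k: "fst v = 3 * k - c * snd v" ..
    show "quad_form (9 * A) (3 * B - 6 * A * c) (A * c * c - B * c + C) (T v) = quad_form A B C v"
      unfolding T_def quad_form_def k by (simp add: algebra_simps)
  next
    fix v w assume "3 dvd lin_form f v" "3 dvd lin_form f w"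
    from x[OF this(1)] x[OF this(2)] obtain k l
      where kl: "fst v = 3 * k - c * snd v" "fst w = 3 * l - c * snd w" by blast
    show "cross v w = 3 * cross (T v) (T w)"
      unfolding T_def cross_def kl by (simp add: algebra_simps)
  next
    fix V assume V: "\<And>v. v \<in> V \<Longrightarrow> 3 dvd lin_form f v" and "third_colorable (T ` V)"
    then obtain p where p: "\<forall>v\<in>V. middle_third (pairing p (T v))"
      unfolding third_colorable_def by blast
    have "pairing (fst p / 3, snd p + of_int c * fst p / 3) v = pairing p (T v)" if v: "v \<in> V" for v
    proof -
      from x[OF V[OF v]] obtain k where k: "fst v = 3 * k - c * snd v" ..
      show ?thesis unfolding T_def pairing_def k by (simp add: field_simps)
    qed
    then show "third_colorable V" unfolding third_colorable_def using p by metis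
  qed
qed

text \<open>The descent ends because \<open>\<bar>N\<bar> * \<bar>cross a b\<bar>\<close> is a
  positive integer: passing to a sublattice divides the second factor by 3 and keeps
  \<open>N\<close>, and dividing the form by 3 does the reverse.\<close>

lemma third_colorable_quad_form:
  assumes "finite V" "card V \<le> 4" "\<And>v. v \<in> V \<Longrightarrow> quad_form A B C v = N" "N \<noteq> 0"
    and "a \<in> V" "b \<in> V" "cross a b \<noteq> 0"
  shows "third_colorable V"
  using assms
proof (induction "nat (\<bar>N\<bar> * \<bar>cross a b\<bar>)" arbitrary: V A B C N a b rule: less_induct)
  case less
  note prems = less.prems
  have descent: "third_colorable V"
    if f: "\<not> (3 dvd fst f \<and> 3 dvd snd f)" and V: "\<And>v. v \<in> V \<Longrightarrow> 3 dvd lin_form f v" for f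
  proof -
    obtain T A' B' C' where
      Q: "\<And>v. 3 dvd lin_form f v \<Longrightarrow> quad_form A' B' C' (T v) = quad_form A B C v"
      and cross: "\<And>v w. 3 dvd lin_form f v \<Longrightarrow> 3 dvd lin_form f w \<Longrightarrow> cross v w = 3 * cross (T v) (T w)"
      and lift: "\<And>W. (\<And>v. v \<in> W \<Longrightarrow> 3 dvd lin_form f v) \<Longrightarrow> third_colorable (T ` W) \<Longrightarrow> third_colorable W"
      by (rule sublattice_coordinates[OF f, of A B C]) blast
    have c: "cross a b = 3 * cross (T a) (T b)" using cross V prems by blast
    have "\<bar>N\<bar> * \<bar>cross (T a) (T b)\<bar> < \<bar>N\<bar> * \<bar>cross a b\<bar>"
      using prems c by (intro mult_strict_left_mono) auto
    then have "nat (\<bar>N\<bar> * \<bar>cross (T a) (T b)\<bar>) < nat (\<bar>N\<bar> * \<bar>cross a b\<bar>)"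
      by (subst nat_less_eq_zless) simp_all
    then have "third_colorable (T ` V)"
    proof (rule less.hyps[of N "T a" "T b" "T ` V" A' B' C'])
      show "card (T ` V) \<le> 4" using prems card_image_le[of V T] by linarith
    qed (use prems Q V c in auto)
    with V show ?thesis by (rule lift)
  qed
  show ?case
  proof (cases "3 dvd N")
    case False
    then show ?thesis
      using lin_form_nonvanishing_mod_3[OF False, of A B C] third_colorable_if_lin_form prems by metis
  next
    case N: True
    show ?thesis
    proof (cases "3 dvd A \<and> 3 dvd B \<and> 3 dvd C")
      case True
      then obtain A' B' C' N' where *: "A = 3 * A'" "B = 3 * B'" "C = 3 * C'" "N = 3 * N'"
        using N by (meson dvdE)
      have "\<bar>N'\<bar> * \<bar>cross a b\<bar> < \<bar>N\<bar> * \<bar>cross a b\<bar>"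
        using prems * by (intro mult_strict_right_mono) auto
      then have "nat (\<bar>N'\<bar> * \<bar>cross a b\<bar>) < nat (\<bar>N\<bar> * \<bar>cross a b\<bar>)"
        by (subst nat_less_eq_zless) simp_all
      moreover have "quad_form A' B' C' v = N'" if "v \<in> V" for v
        using prems(3)[OF that] by (simp add: * quad_form_def)
      ultimately show ?thesis
        using prems * by (intro less.hyps[of N' a b V A' B' C']) auto
    next
      case False
      then obtain f g where fg: "\<not> (3 dvd fst f \<and> 3 dvd snd f)" "\<not> (3 dvd fst g \<and> 3 dvd snd g)"
        "\<And>v. 3 dvd quad_form A B C v \<Longrightarrow> 3 dvd lin_form f v \<or> 3 dvd lin_form g v"
        by (rule quad_form_mod_3_factors) blast
      show ?thesis
      proof (cases "(\<forall>v\<in>V. 3 dvd lin_form f v) \<or> (\<forall>v\<in>V. 3 dvd lin_form g v)")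
        case True
        then show ?thesis using descent fg by blast
      next
        case False
        then obtain v w where "v \<in> V" "\<not> 3 dvd lin_form f v" "w \<in> V" "\<not> 3 dvd lin_form g w"
          by blast
        then show ?thesis
          using prems fg N by (intro third_colorable_two_forms[of V A B C N f g v w]) auto
      qed
    qed
  qed
qed

section \<open>Additive maps through linear algebra over the rationals\<close>

interpretation rat_vs: vector_space "\<lambda>(r::rat) (x::'a::real_vector). of_rat r *\<^sub>R x"
  by unfold_locales (simp_all add: of_rat_add of_rat_mult scaleR_add_left scaleR_add_right)

interpretation rat_vs_real: vector_space_pair
  "\<lambda>(r::rat) (x::'a::real_vector). of_rat r *\<^sub>R x" "\<lambda>(r::rat) (x::real). of_rat r * x"
  by unfold_locales (simp_all add: of_rat_add of_rat_mult algebra_simps)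

text \<open>Only rational linearity is asked of \<open>\<phi>\<close>, so values can be prescribed
  freely even on vectors that are dependent over the reals; \<open>\<phi>\<close> may be
  discontinuous.\<close>

lemma ex_additive_extending:
  fixes B :: "'a::real_vector set"
  assumes "rat_vs.independent B"
  obtains \<phi> :: "'a \<Rightarrow> real" where "\<And>x y. \<phi> (x + y) = \<phi> x + \<phi> y"
    "\<And>r x. \<phi> (of_rat r *\<^sub>R x) = of_rat r * \<phi> x" "\<And>b. b \<in> B \<Longrightarrow> \<phi> b = t b"
proof -
  from rat_vs_real.linear_independent_extend[OF assms, of t] obtain \<phi>
    where lin: "Vector_Spaces.linear (\<lambda>r. (*\<^sub>R) (real_of_rat r)) (\<lambda>r. (*) (real_of_rat r)) \<phi>"
      and t: "\<forall>b\<in>B. \<phi> b = t b"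
    by blast
  show thesis
    using that rat_vs_real.linear_add[OF lin] rat_vs_real.linear_scale[OF lin] t by blast
qed

lemma ex_additive_pair:
  fixes a b :: "'a::real_vector"
  assumes "rat_vs.independent {a, b}" "a \<noteq> b"
  obtains \<phi> :: "'a \<Rightarrow> real" where "\<And>x y. \<phi> (x + y) = \<phi> x + \<phi> y"
    "\<And>r x. \<phi> (of_rat r *\<^sub>R x) = of_rat r * \<phi> x" "\<phi> a = s" "\<phi> b = t"
proof -
  obtain \<phi> :: "'a \<Rightarrow> real" where \<phi>: "\<And>x y. \<phi> (x + y) = \<phi> x + \<phi> y"
    "\<And>r x. \<phi> (of_rat r *\<^sub>R x) = of_rat r * \<phi> x"
    "\<And>v. v \<in> {a, b} \<Longrightarrow> \<phi> v = (if v = a then s else t)"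
    by (rule ex_additive_extending[OF assms(1), of "\<lambda>v. if v = a then s else t"]) (rule that)
  show thesis
    by (rule that[OF \<phi>(1,2)]) (use \<phi>(3)[of a] \<phi>(3)[of b] assms(2) in auto)
qed

text \<open>If some coefficient is not 0, 1 or -1, \<open>middle_third_rat_step\<close> adjusts its
  variable while all others are 1/2. If two coefficients are 1 or -1, their variables are tied
  together up to sign, which produces a coefficient 2 or -2. Otherwise the sum is a single term, and
  1/2 works.\<close>

lemma middle_third_rat_combination:
  fixes r :: "'i \<Rightarrow> rat"
  assumes "finite I" "i \<in> I" "r i \<noteq> 0"
  obtains x where "\<And>i. middle_third (x i)" "middle_third (\<Sum>i\<in>I. of_rat (r i) * x i)"
proof -
  have half: "middle_third (1/2)" by (rule middle_third_half)
  consider j where "j \<in> I" "r j \<noteq> 0" "r j \<noteq> 1" "r j \<noteq> -1"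
    | j where "j \<in> I" "j \<noteq> i" "r i = 1 \<or> r i = -1" "r j = 1 \<or> r j = -1"
    | "r i = 1 \<or> r i = -1" "\<And>j. j \<in> I \<Longrightarrow> j \<noteq> i \<Longrightarrow> r j = 0"
    using assms by metis
  then show thesis
  proof cases
    case 1
    obtain t where t: "middle_third t"
        "middle_third (of_rat (r j) * t + (\<Sum>i\<in>I - {j}. of_rat (r i) * (1/2)))"
      using middle_third_rat_step[OF 1(2-4)] by blast
    define x where "x = (\<lambda>i. 1/2)(j := t)"
    have "(\<Sum>i\<in>I. of_rat (r i) * x i) = of_rat (r j) * x j + (\<Sum>i\<in>I - {j}. of_rat (r i) * x i)"
      using assms 1 by (intro sum.remove) auto
    also have "(\<Sum>i\<in>I - {j}. of_rat (r i) * x i) = (\<Sum>i\<in>I - {j}. of_rat (r i) * (1/2))"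
      by (intro sum.cong) (auto simp: x_def)
    finally show thesis
      using t half by (intro that[of x]) (simp_all add: x_def)
  next
    case 2
    define c where "c = (\<Sum>k\<in>I - {i} - {j}. of_rat (r k) * (1/2) :: real)"
    have "2 * r i \<noteq> 0" "2 * r i \<noteq> 1" "2 * r i \<noteq> -1" using 2 by auto
    then obtain t where t: "middle_third t" "middle_third (of_rat (2 * r i) * t + c)"
      using middle_third_rat_step by blast
    define x where "x = (\<lambda>i. 1/2)(i := t, j := of_rat (r i * r j) * t)"
    have "(\<Sum>i\<in>I. of_rat (r i) * x i)
        = of_rat (r i) * x i + (of_rat (r j) * x j + (\<Sum>k\<in>I - {i} - {j}. of_rat (r k) * x k))"
      using assms 2 by (simp add: sum.remove[of I i] sum.remove[of "I - {i}" j])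
    also have "(\<Sum>k\<in>I - {i} - {j}. of_rat (r k) * x k) = c"
      unfolding c_def by (intro sum.cong) (auto simp: x_def)
    also have "of_rat (r i) * x i + (of_rat (r j) * x j + c) = of_rat (2 * r i) * t + c"
      using 2 by (auto simp: x_def of_rat_mult)
    finally show thesis
      using t half 2 by (intro that[of x]) (auto simp: x_def)
  next
    case 3
    have "(\<Sum>j\<in>I. of_rat (r j) * (1/2)) = (\<Sum>j\<in>{i}. of_rat (r j) * (1/2) :: real)"
      using assms 3 by (intro sum.mono_neutral_right) auto
    then have "(\<Sum>j\<in>I. of_rat (r j) * (1/2)) = (1/2 :: real) \<or> (\<Sum>j\<in>I. of_rat (r j) * (1/2)) = - (1/2 :: real)"
      using 3(1) by auto
    then have "middle_third (\<Sum>j\<in>I. of_rat (r j) * (1/2))"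
      using half middle_third_uminus[of "1/2"] by metis
    then show thesis using half by (rule that[rotated])
  qed
qed

lemma additive_sum:
  assumes "\<And>x y. \<phi> (x + y) = \<phi> x + \<phi> y" "\<And>r x. \<phi> (of_rat r *\<^sub>R x) = of_rat r * \<phi> x"
  shows "\<phi> (\<Sum>b\<in>B. of_rat (u b) *\<^sub>R b) = (\<Sum>b\<in>B. of_rat (u b) * \<phi> b :: real)"
proof -
  have "\<phi> 0 = 0" using assms(1)[of 0 0] by simp
  then show ?thesis by (induction B rule: infinite_finite_induct) (simp_all add: assms)
qed

lemma ex_additive_middle_third_insert:
  fixes B :: "'a::real_vector set"
  assumes B: "rat_vs.independent B" "finite B" and d: "d \<in> rat_vs.span B" "d \<noteq> 0"
  obtains \<phi> :: "'a \<Rightarrow> real" where "\<And>x y. \<phi> (x + y) = \<phi> x + \<phi> y" "\<And>b. b \<in> insert d B \<Longrightarrow> middle_third (\<phi> b)"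
proof -
  obtain u where u: "d = (\<Sum>b\<in>B. of_rat (u b) *\<^sub>R b)"
    using d(1) unfolding rat_vs.span_finite[OF B(2)] by blast
  then obtain b where "b \<in> B" "u b \<noteq> 0"
    using d(2) by (metis (no_types, lifting) of_rat_0 scaleR_zero_left sum.neutral)
  then obtain t where t: "\<And>b. middle_third (t b)" "middle_third (\<Sum>b\<in>B. of_rat (u b) * t b)"
    using middle_third_rat_combination[of B b u] B(2) by blast
  obtain \<phi> :: "'a \<Rightarrow> real" where \<phi>: "\<And>x y. \<phi> (x + y) = \<phi> x + \<phi> y"
    "\<And>r x. \<phi> (of_rat r *\<^sub>R x) = of_rat r * \<phi> x" "\<And>b. b \<in> B \<Longrightarrow> \<phi> b = t b"
    using ex_additive_extending[OF B(1)] by blast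
  have "\<phi> d = (\<Sum>b\<in>B. of_rat (u b) * t b)"
    unfolding u additive_sum[of \<phi>, OF \<phi>(1,2)] by (intro sum.cong) (simp_all add: \<phi>(3))
  then show thesis using t \<phi>(3) by (intro that[OF \<phi>(1)]) auto
qed

lemma finite_rat_common_denominator:
  fixes S :: "rat set"
  assumes "finite S"
  obtains m :: int where "m > 0" "\<And>r. r \<in> S \<Longrightarrow> \<exists>k. r * of_int m = of_int k"
  using assms
proof (induction S arbitrary: thesis rule: finite_induct)
  case empty
  then show ?case using zero_less_one by blast
next
  case (insert r S)
  obtain m :: int where m: "m > 0" "\<And>r. r \<in> S \<Longrightarrow> \<exists>k. r * of_int m = of_int k"
    using insert.IH by blast
  obtain p q where "quotient_of r = (p, q)" by (cases "quotient_of r")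
  then have q: "q > 0" "r = of_int p / of_int q"
    using quotient_of_denom_pos quotient_of_div by auto
  have "\<exists>k. s * of_int (m * q) = of_int k" if "s \<in> insert r S" for s
  proof (cases "s = r")
    case True
    then have "s * of_int (m * q) = of_int (p * m)" using q by simp
    then show ?thesis ..
  next
    case False
    then have "s \<in> S" using that by simp
    then obtain k where "s * of_int m = of_int k" using m(2) by blast
    then have "s * of_int (m * q) = of_int (k * q)" by (metis mult.assoc of_int_mult)
    then show ?thesis ..
  qed
  then show ?case using insert.prems[of "m * q"] m(1) q(1) by auto
qed

lemma unit_vector_rat_multiple:
  fixes a :: "'a::real_normed_vector"
  assumes "norm a = 1" "norm (of_rat r *\<^sub>R a) = 1"
  shows "r = 1 \<or> r = -1"
proof -
  have "\<bar>of_rat r\<bar> = (1::real)" using assms by simp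
  then have "of_rat r = (of_rat 1 :: real) \<or> of_rat r = (of_rat (-1) :: real)" by (auto simp: abs_if split: if_splits)
  then show ?thesis by (simp only: of_rat_eq_iff)
qed

text \<open>If some vector is a combination of \<open>a\<close> and \<open>b\<close> with two nonzero coefficients, then \<open>a \<bullet> b\<close> is
  rational, so that after clearing denominators the squared norm is an integral quadratic form.\<close>

lemma ex_additive_middle_third_rank_2:
  fixes W :: "'a::real_inner set"
  assumes W: "finite W" "card W \<le> 4" "\<And>w. w \<in> W \<Longrightarrow> norm w = 1"
    and ab: "a \<in> W" "b \<in> W" "a \<noteq> b" "rat_vs.independent {a, b}" "W \<subseteq> rat_vs.span {a, b}"
  obtains \<phi> :: "'a \<Rightarrow> real" where "\<And>x y. \<phi> (x + y) = \<phi> x + \<phi> y" "\<And>w. w \<in> W \<Longrightarrow> middle_third (\<phi> w)"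
proof -
  note thesisI = that
  have "\<exists>r s. w = of_rat r *\<^sub>R a + of_rat s *\<^sub>R b" if w: "w \<in> W" for w
  proof -
    obtain u where "w = (\<Sum>v\<in>{a, b}. of_rat (u v) *\<^sub>R v)"
      using ab(5) w by (auto simp: rat_vs.span_finite)
    then have "w = of_rat (u a) *\<^sub>R a + of_rat (u b) *\<^sub>R b" using ab(3) by simp
    then show ?thesis by blast
  qed
  then obtain r s where rs: "\<And>w. w \<in> W \<Longrightarrow> w = of_rat (r w) *\<^sub>R a + of_rat (s w) *\<^sub>R b"
    by metis
  have ext: thesis if "\<And>w. w \<in> W \<Longrightarrow> middle_third (of_rat (r w) * x + of_rat (s w) * y)" for x y
  proof -
    obtain \<phi> :: "'a \<Rightarrow> real" where \<phi>: "\<And>x y. \<phi> (x + y) = \<phi> x + \<phi> y"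
      "\<And>r x. \<phi> (of_rat r *\<^sub>R x) = of_rat r * \<phi> x" "\<phi> a = x" "\<phi> b = y"
      using ex_additive_pair[OF ab(4,3)] by blast
    have "\<phi> w = of_rat (r w) * x + of_rat (s w) * y" if "w \<in> W" for w
      using rs[OF that] \<phi> by metis
    then show thesis using thesisI[OF \<phi>(1)] that by metis
  qed
  have unit: "norm a = 1" "norm b = 1" using W ab by auto
  show thesis
  proof (cases "\<forall>w\<in>W. r w = 0 \<or> s w = 0")
    case True
    \<comment> \<open>Every vector is now \<open>a\<close> or \<open>b\<close> up to sign.\<close>
    have "middle_third (of_rat (r w) * (1/2) + of_rat (s w) * (1/2))" if w: "w \<in> W" for w
    proof -
      have "norm (of_rat (r w) *\<^sub>R a + of_rat (s w) *\<^sub>R b) = 1"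
        using rs[OF w] W(3)[OF w] by simp
      then have "(r w = 1 \<or> r w = -1) \<and> s w = 0 \<or> r w = 0 \<and> (s w = 1 \<or> s w = -1)"
        using True w unit unit_vector_rat_multiple[of a "r w"] unit_vector_rat_multiple[of b "s w"]
        by (metis add.left_neutral add.right_neutral of_rat_0 scaleR_zero_left)
      then show ?thesis
        using middle_third_half middle_third_uminus[of "1/2"] by auto
    qed
    then show thesis by (rule ext)
  next
    case False
    have norm_eq: "of_rat (r w) ^ 2 + of_rat (s w) ^ 2 + 2 * of_rat (r w) * of_rat (s w) * (a \<bullet> b) = 1"
      if w: "w \<in> W" for w
    proof -
      have "a \<bullet> a = 1" "b \<bullet> b = 1" using unit by (simp_all add: norm_eq_1)
      moreover have "w \<bullet> w = 1" using W(3)[OF w] by (simp add: norm_eq_1)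
      then have "(of_rat (r w) *\<^sub>R a + of_rat (s w) *\<^sub>R b) \<bullet> (of_rat (r w) *\<^sub>R a + of_rat (s w) *\<^sub>R b) = 1"
        using rs[OF w] by simp
      ultimately show ?thesis
        by (simp add: inner_add_left inner_add_right inner_commute[of b a] power2_eq_square algebra_simps)
    qed
    obtain w where w: "w \<in> W" "r w \<noteq> 0" "s w \<noteq> 0" using False by blast
    have "a \<bullet> b = of_rat ((1 - r w ^ 2 - s w ^ 2) / (2 * r w * s w))"
      using norm_eq[OF w(1)] w by (simp add: of_rat_divide of_rat_mult of_rat_add of_rat_diff of_rat_power field_simps)
    then obtain k where k: "a \<bullet> b = of_rat k" by blast
    obtain P R where "quotient_of k = (P, R)" by (cases "quotient_of k")
    then have R: "R > 0" "k = of_int P / of_int R"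
      using quotient_of_denom_pos quotient_of_div by auto
    obtain m :: int where m: "m > 0" "\<And>q. q \<in> r ` W \<union> s ` W \<Longrightarrow> \<exists>k. q * of_int m = of_int k"
      using finite_rat_common_denominator[of "r ` W \<union> s ` W"] W(1) by auto
    then have "\<forall>w\<in>W. \<exists>k. r w * of_int m = of_int k" "\<forall>w\<in>W. \<exists>k. s w * of_int m = of_int k"
      by blast+
    then obtain x y where xy: "\<And>w. w \<in> W \<Longrightarrow> r w * of_int m = of_int (x w)"
        "\<And>w. w \<in> W \<Longrightarrow> s w * of_int m = of_int (y w)"
      unfolding bchoice_iff by blast
    \<comment> \<open>Coordinates are scaled by the common denominator \<open>m\<close>. Entering
      \<open>a\<close> and \<open>b\<close> directly as \<open>(m, 0)\<close> and
      \<open>(0, m)\<close> avoids an appeal to uniqueness of coordinates.\<close>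
    define V where "V = insert (m, 0) (insert (0, m) ((\<lambda>w. (x w, y w)) ` (W - {a, b})))"
    have "third_colorable V"
    proof (rule third_colorable_quad_form)
      show "finite V" using W(1) by (simp add: V_def)
      have "card ((\<lambda>w. (x w, y w)) ` (W - {a, b})) \<le> card (W - {a, b})"
        using W(1) by (intro card_image_le) auto
      also have "\<dots> \<le> 2" using W ab by (subst card_Diff_subset) auto
      finally show "card V \<le> 4"
        unfolding V_def using W(1) by (simp add: card_insert_if)
      show "(m, 0) \<in> V" "(0, m) \<in> V" "cross (m, 0) (0, m) \<noteq> 0" "R * m * m \<noteq> 0"
        using m R by (auto simp: V_def cross_def)
      \<comment> \<open>The squared norm, with \<open>a \<bullet> b = P / R\<close>, multiplied by
        \<open>R * m * m\<close>.\<close>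
      have "quad_form R (2 * P) R (x w, y w) = R * m * m" if w: "w \<in> W" for w
      proof -
        have "r w ^ 2 + s w ^ 2 + 2 * r w * s w * k = 1"
        proof -
          have "(of_rat (r w ^ 2 + s w ^ 2 + 2 * r w * s w * k) :: real) = of_rat 1"
            using norm_eq[OF w] by (simp add: k of_rat_add of_rat_mult of_rat_power)
          then show ?thesis by (simp only: of_rat_eq_iff)
        qed
        then have "(r w ^ 2 + s w ^ 2 + 2 * r w * s w * k) * of_int R * of_int m * of_int m
            = of_int R * of_int m * of_int m" by simp
        moreover have P: "of_int P = k * of_int R" using R by simp
        ultimately have "of_int R * (r w * of_int m) * (r w * of_int m)
            + 2 * of_int P * (r w * of_int m) * (s w * of_int m)
            + of_int R * (s w * of_int m) * (s w * of_int m) = of_int R * of_int m * of_int m"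
          unfolding P by (simp add: algebra_simps power2_eq_square)
        then have "(of_int (quad_form R (2 * P) R (x w, y w)) :: rat) = of_int (R * m * m)"
          unfolding xy[OF w] by (simp add: quad_form_def)
        then show ?thesis by (simp only: of_int_eq_iff)
      qed
      then show "quad_form R (2 * P) R v = R * m * m" if "v \<in> V" for v
        using that by (auto simp: V_def quad_form_def)
    qed
    then obtain p where p: "\<And>v. v \<in> V \<Longrightarrow> middle_third (pairing p v)"
      unfolding third_colorable_def by blast
    obtain \<phi> :: "'a \<Rightarrow> real" where \<phi>: "\<And>x y. \<phi> (x + y) = \<phi> x + \<phi> y"
      "\<And>r x. \<phi> (of_rat r *\<^sub>R x) = of_rat r * \<phi> x" "\<phi> a = of_int m * fst p" "\<phi> b = of_int m * snd p"
      using ex_additive_pair[OF ab(4,3)] by blast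
    have "middle_third (\<phi> w)" if w: "w \<in> W" for w
    proof -
      consider "w = a" | "w = b" | "w \<in> W - {a, b}" using w by blast
      then show ?thesis
      proof cases
        case 1
        then show ?thesis using p[of "(m, 0)"] \<phi>(3) by (simp add: V_def pairing_def)
      next
        case 2
        then show ?thesis using p[of "(0, m)"] \<phi>(4) by (simp add: V_def pairing_def)
      next
        case 3
        have "\<phi> w = of_rat (r w * of_int m) * fst p + of_rat (s w * of_int m) * snd p"
          using arg_cong[OF rs[OF w], of \<phi>] by (simp add: \<phi> of_rat_mult)
        then have "\<phi> w = pairing p (x w, y w)"
          unfolding xy[OF w] by (simp add: pairing_def)
        then show ?thesis using p[of "(x w, y w)"] 3 by (simp add: V_def)
      qed
    qed
    then show thesis by (rule thesisI[OF \<phi>(1)])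
  qed
qed

text \<open>Serves both the two-color bound and the easiest case of the three-color bound. When
  \<open>B\<close> is a singleton, the unit vectors among its rational multiples are the two signs
  of one vector.\<close>

lemma ex_additive_half:
  fixes W :: "'a::real_normed_vector set"
  assumes W: "finite W" "\<And>w. w \<in> W \<Longrightarrow> norm w = 1"
    and B: "B \<subseteq> W" "rat_vs.independent B" "W \<subseteq> rat_vs.span B" "W = B \<or> card B \<le> 1"
  obtains \<phi> :: "'a \<Rightarrow> real" where "\<And>x y. \<phi> (x + y) = \<phi> x + \<phi> y"
    "\<And>w. w \<in> W \<Longrightarrow> \<phi> w = 1/2 \<or> \<phi> w = -1/2"
proof -
  obtain \<phi> :: "'a \<Rightarrow> real" where \<phi>: "\<And>x y. \<phi> (x + y) = \<phi> x + \<phi> y"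
    "\<And>r x. \<phi> (of_rat r *\<^sub>R x) = of_rat r * \<phi> x" "\<And>b. b \<in> B \<Longrightarrow> \<phi> b = 1/2"
    by (rule ex_additive_extending[OF B(2), of "\<lambda>_. 1/2"]) (rule that)
  have "\<phi> w = 1/2 \<or> \<phi> w = -1/2" if w: "w \<in> W" for w
  proof (cases "W = B")
    case True
    then show ?thesis using w \<phi>(3) by simp
  next
    case False
    have finB: "finite B" using B(1) W(1) finite_subset by blast
    obtain u where u: "w = (\<Sum>b\<in>B. of_rat (u b) *\<^sub>R b)"
      using B(3) w by (auto simp: rat_vs.span_finite[OF finB])
    have "B \<noteq> {}" using u W(2)[OF w] by auto
    then have "card B = 1" using False B(4) finB by (simp add: le_Suc_eq)
    then obtain a where a: "B = {a}" by (auto simp: card_1_singleton_iff)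
    then have wa: "w = of_rat (u a) *\<^sub>R a" using u by simp
    have "norm a = 1" "norm (of_rat (u a) *\<^sub>R a) = 1"
      using W(2) B(1) a W(2)[OF w] unfolding wa by auto
    then have "u a = 1 \<or> u a = -1"
      by (rule unit_vector_rat_multiple)
    then show ?thesis
      using \<phi>(2)[of "u a" a] \<phi>(3)[of a] a by (auto simp: wa)
  qed
  then show thesis by (rule that[OF \<phi>(1)])
qed

lemma ex_additive_middle_third:
  fixes W :: "'a::real_inner set"
  assumes W: "finite W" "card W \<le> 4" "\<And>w. w \<in> W \<Longrightarrow> norm w = 1"
  obtains \<phi> :: "'a \<Rightarrow> real" where "\<And>x y. \<phi> (x + y) = \<phi> x + \<phi> y" "\<And>w. w \<in> W \<Longrightarrow> middle_third (\<phi> w)"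
proof -
  obtain B where B: "B \<subseteq> W" "rat_vs.independent B" "W \<subseteq> rat_vs.span B"
    by (rule rat_vs.maximal_independent_subset)
  have finB: "finite B" using B(1) W(1) finite_subset by blast
  have card: "card (W - B) = card W - card B" using B finB by (simp add: card_Diff_subset)
  consider "W = B \<or> card B \<le> 1" | d where "W = insert d B" | "card B = 2"
  proof -
    assume *: "W = B \<or> card B \<le> 1 \<Longrightarrow> thesis" "\<And>d. W = insert d B \<Longrightarrow> thesis" "card B = 2 \<Longrightarrow> thesis"
    \<comment> \<open>Among at most four vectors, three independent ones leave at most one outside
      \<open>B\<close>.\<close>
    have "card B \<le> 1 \<or> card B = 2 \<or> card (W - B) = 0 \<or> card (W - B) = 1"
      using card W(2) by linarith
    moreover have thesis if "card (W - B) = 0"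
      using that W(1) B(1) by (intro *(1)) auto
    moreover have thesis if "card (W - B) = 1"
    proof -
      from that obtain d where "W - B = {d}" by (auto simp: card_1_singleton_iff)
      then show thesis using B(1) by (intro *(2)[of d]) auto
    qed
    ultimately show thesis using *(1,3) by blast
  qed
  then show thesis
  proof cases
    case 1
    obtain \<phi> :: "'a \<Rightarrow> real" where \<phi>: "\<And>x y. \<phi> (x + y) = \<phi> x + \<phi> y"
      "\<And>w. w \<in> W \<Longrightarrow> \<phi> w = 1/2 \<or> \<phi> w = -1/2"
      by (rule ex_additive_half[OF W(1,3) B 1]) (assumption, rule that)
    have "middle_third (\<phi> w)" if "w \<in> W" for w
      using \<phi>(2)[OF that] middle_third_half middle_third_uminus[of "1/2"] by (metis minus_divide_left)
    then show thesis by (rule that[OF \<phi>(1)])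
  next
    case 2
    have "d \<in> W" using 2 by simp
    have "d \<noteq> 0" using W(3)[OF \<open>d \<in> W\<close>] by auto
    moreover have "d \<in> rat_vs.span B" using B(3) \<open>d \<in> W\<close> by blast
    ultimately obtain \<phi> :: "'a \<Rightarrow> real" where "\<And>x y. \<phi> (x + y) = \<phi> x + \<phi> y"
      "\<And>b. b \<in> insert d B \<Longrightarrow> middle_third (\<phi> b)"
      using ex_additive_middle_third_insert[OF B(2) finB, of d] by blast
    then show thesis unfolding 2[symmetric] by (rule that)
  next
    case 3
    then obtain a b where "B = {a, b}" "a \<noteq> b" by (auto simp: card_2_iff)
    then show thesis
      using ex_additive_middle_third_rank_2[OF W, of a b thesis] B that by auto
  qed
qed

section \<open>From additive maps to colorings\<close>

text \<open>Up to a multiple of \<open>m\<close>, the argument of the floor increases by an amount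
  between 1 and \<open>m - 1\<close>, hence so does the floor. For \<open>m = 3\<close> the
  condition on \<open>y\<close> is \<open>middle_third\<close>; for \<open>m = 2\<close> it says
  that \<open>y\<close> is a half-integer.\<close>

lemma floor_mod_neq:
  fixes x y :: real and k :: int
  assumes "m > 0" "1 / of_nat m \<le> y - of_int k" "y - of_int k \<le> 1 - 1 / of_nat m"
  shows "\<lfloor>of_nat m * (x + y)\<rfloor> mod int m \<noteq> \<lfloor>of_nat m * x\<rfloor> mod int m"
proof
  assume "\<lfloor>of_nat m * (x + y)\<rfloor> mod int m = \<lfloor>of_nat m * x\<rfloor> mod int m"
  then obtain j where j: "\<lfloor>of_nat m * (x + y)\<rfloor> - \<lfloor>of_nat m * x\<rfloor> = int m * j"
    by (auto simp: mod_eq_dvd_iff elim: dvdE)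
  define d where "d = \<lfloor>of_nat m * x + of_nat m * (y - of_int k)\<rfloor> - \<lfloor>of_nat m * x\<rfloor>"
  have "of_nat m * (x + y) = of_nat m * x + of_nat m * (y - of_int k) + of_int (int m * k)"
    by (simp add: algebra_simps)
  then have "\<lfloor>of_nat m * (x + y)\<rfloor> = \<lfloor>of_nat m * x + of_nat m * (y - of_int k)\<rfloor> + int m * k"
    by (simp only: floor_add_int[symmetric])
  then have "d = int m * (j - k)"
    using j by (simp add: d_def algebra_simps)
  moreover have "1 \<le> of_nat m * (y - of_int k)" "of_nat m * (y - of_int k) \<le> of_nat m - 1"
    using assms by (simp_all add: field_simps)
  then have "1 \<le> d" "d \<le> int m - 1"
    unfolding d_def by linarith+
  ultimately have "0 < int m * (j - k)" "int m * (j - k) < int m * 1" by simp_all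
  then have "0 < j - k" "j - k < 1"
    using assms(1) by (simp_all only: zero_less_mult_iff mult_less_cancel_left) auto
  then show False by linarith
qed

lemma chromatic_number_Cay_le:
  fixes \<phi> :: "'a::ab_group_add \<Rightarrow> real"
  assumes add: "\<And>x y. \<phi> (x + y) = \<phi> x + \<phi> y" and "m > 0"
    and \<phi>: "\<And>i. i \<in> {1..n} \<Longrightarrow> \<exists>k::int. 1 / of_nat m \<le> \<phi> (v i) - of_int k \<and> \<phi> (v i) - of_int k \<le> 1 - 1 / of_nat m"
  shows "chromatic_number (Cay G (pm_set n v)) \<le> enat m"
proof (rule chromatic_number_le)
  define c where "c x = nat (\<lfloor>of_nat m * \<phi> x\<rfloor> mod int m)" for x
  have c_neq: "c (x + v i) \<noteq> c x" if "i \<in> {1..n}" for x i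
    using \<phi>[OF that] floor_mod_neq[OF \<open>m > 0\<close>, of "\<phi> (v i)" _ "\<phi> x"] \<open>m > 0\<close>
    by (auto simp: c_def add eq_nat_nat_iff)
  have "c x \<noteq> c y" if "- x + y \<in> pm_set n v" for x y
  proof -
    from that obtain i where i: "i \<in> {1..n}" "- x + y = v i \<or> - x + y = - v i"
      by (auto simp: pm_set_def)
    then have "y = x + v i \<or> x = y + v i" by (auto simp: algebra_simps)
    then show ?thesis using c_neq[OF i(1)] by metis
  qed
  then show "proper_coloring (Cay G (pm_set n v)) c"
    by (auto simp: proper_coloring_def Cay_def)
  show "c ` pverts (Cay G (pm_set n v)) \<subseteq> {..<m}"
    using \<open>m > 0\<close> by (auto simp: c_def nat_less_iff)
qed

section \<open>Clique bounds and the values of the maximum\<close>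

lemma chromatic_number_ge_clique:
  assumes "K \<subseteq> pverts X" "finite K" "\<And>x y. x \<in> K \<Longrightarrow> y \<in> K \<Longrightarrow> x \<noteq> y \<Longrightarrow> (x, y) \<in> parcs X"
  shows "enat (card K) \<le> chromatic_number X"
  unfolding chromatic_number_def
proof (rule Inf_greatest)
  fix e assume "e \<in> {enat k |k. \<exists>c. proper_coloring X c \<and> c ` pverts X \<subseteq> {..<k}}"
  then obtain k c where e: "e = enat k" and c: "proper_coloring X c" "c ` pverts X \<subseteq> {..<k}" by blast
  have "inj_on c K"
    using assms(3) c(1) unfolding proper_coloring_def inj_on_def by blast
  then have "card K = card (c ` K)" by (simp add: card_image)
  also have "\<dots> \<le> card {..<k}" using assms(1) c(2) by (intro card_mono) auto
  finally show "enat (card K) \<le> e" by (simp add: e)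
qed

lemma chi_max_eqI:
  fixes v :: "nat \<Rightarrow> real^2"
  assumes "\<And>v :: nat \<Rightarrow> real^2. \<forall>i\<in>{1..n}. norm (v i) = 1 \<Longrightarrow>
      chromatic_number (Cay (group_closure (pm_set n v)) (pm_set n v)) \<le> k"
    and "\<forall>i\<in>{1..n}. norm (v i) = 1" "k \<le> chromatic_number (Cay (group_closure (pm_set n v)) (pm_set n v))"
  shows "chi_max n = k"
  unfolding chi_max_def
proof (rule Max_eqI)
  show "finite (unit_cayley_chromatic_numbers n)" by (rule finite_unit_cayley_chromatic_numbers)
  show "e \<le> k" if "e \<in> unit_cayley_chromatic_numbers n" for e
    using that assms(1) by (auto simp: unit_cayley_chromatic_numbers_def)
  have "chromatic_number (Cay (group_closure (pm_set n v)) (pm_set n v)) = k"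
    using assms by (intro antisym) auto
  then show "k \<in> unit_cayley_chromatic_numbers n"
    using assms(2) unfolding unit_cayley_chromatic_numbers_def by blast
qed

lemma chromatic_number_le_3:
  fixes v :: "nat \<Rightarrow> 'a::real_inner"
  assumes "n \<le> 4" "\<forall>i\<in>{1..n}. norm (v i) = 1"
  shows "chromatic_number (Cay G (pm_set n v)) \<le> 3"
proof -
  have "card (v ` {1..n}) \<le> 4" using card_image_le[of "{1..n}" v] assms(1) by simp
  then obtain \<phi> :: "'a \<Rightarrow> real" where \<phi>: "\<And>x y. \<phi> (x + y) = \<phi> x + \<phi> y"
      "\<And>w. w \<in> v ` {1..n} \<Longrightarrow> middle_third (\<phi> w)"
    using ex_additive_middle_third[of "v ` {1..n}"] assms(2) by auto
  have "chromatic_number (Cay G (pm_set n v)) \<le> enat 3"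
    using \<phi>(2) by (intro chromatic_number_Cay_le[of \<phi>, OF \<phi>(1)]) (auto simp: middle_third_def)
  then show ?thesis by (simp add: numeral_eq_enat)
qed

lemma chromatic_number_le_2:
  fixes v :: "nat \<Rightarrow> 'a::real_normed_vector"
  assumes "n \<le> 2" "\<forall>i\<in>{1..n}. norm (v i) = 1"
  shows "chromatic_number (Cay G (pm_set n v)) \<le> 2"
proof -
  define W where "W = v ` {1..n}"
  have W: "finite W" "card W \<le> 2" "\<And>w. w \<in> W \<Longrightarrow> norm w = 1"
    using card_image_le[of "{1..n}" v] assms by (auto simp: W_def)
  obtain B where B: "B \<subseteq> W" "rat_vs.independent B" "W \<subseteq> rat_vs.span B"
    by (rule rat_vs.maximal_independent_subset)
  \<comment> \<open>Two distinct vectors are either independent or span a space of dimension one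
    over the rationals.\<close>
  have "W = B \<or> card B \<le> 1"
  proof (rule disjCI)
    assume "\<not> card B \<le> 1"
    then show "W = B" using W B(1) card_seteq[of W B] by simp
  qed
  then obtain \<phi> :: "'a \<Rightarrow> real" where \<phi>: "\<And>x y. \<phi> (x + y) = \<phi> x + \<phi> y"
      "\<And>w. w \<in> W \<Longrightarrow> \<phi> w = 1/2 \<or> \<phi> w = -1/2"
    using ex_additive_half[OF W(1,3) B] by blast
  have "chromatic_number (Cay G (pm_set n v)) \<le> enat 2"
  proof (rule chromatic_number_Cay_le[of \<phi>, OF \<phi>(1)])
    show "\<exists>k::int. 1 / of_nat 2 \<le> \<phi> (v i) - of_int k \<and> \<phi> (v i) - of_int k \<le> 1 - 1 / of_nat 2"
      if "i \<in> {1..n}" for i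
    proof -
      from that have "v i \<in> W" by (simp add: W_def)
      from \<phi>(2)[OF this] show ?thesis
        \<comment> \<open>The integer is 0 for the value 1/2 and -1 for the value -1/2.\<close>
        by (elim disjE) (rule exI[of _ 0], simp, rule exI[of _ "-1"], simp)
    qed
  qed simp
  then show ?thesis by (simp add: numeral_eq_enat)
qed

lemma chromatic_number_ge_2:
  fixes v :: "nat \<Rightarrow> 'a::ab_group_add"
  assumes "1 \<le> n" "v 1 \<noteq> 0"
  shows "2 \<le> chromatic_number (Cay (group_closure (pm_set n v)) (pm_set n v))"
proof -
  have "v 1 \<in> pm_set n v" "- v 1 \<in> pm_set n v" using assms(1) by (auto simp: pm_set_def)
  then have "enat (card {0, v 1}) \<le> chromatic_number (Cay (group_closure (pm_set n v)) (pm_set n v))"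
    by (intro chromatic_number_ge_clique) (auto simp: Cay_def group_closure.base)
  moreover have "card {0, v 1} = 2" using assms(2) by (simp add: card_insert_if)
  ultimately show ?thesis by (simp only: numeral_eq_enat)
qed

text \<open>Generators with sum zero are the sides of a triangle with vertices \<open>0\<close>,
  \<open>v 1\<close>, \<open>v 1 + v 2\<close>.\<close>

lemma chromatic_number_ge_3:
  fixes v :: "nat \<Rightarrow> 'a::ab_group_add"
  assumes n: "3 \<le> n" and sum: "v 1 + v 2 + v 3 = 0" and nz: "v 1 \<noteq> 0" "v 2 \<noteq> 0" "v 3 \<noteq> 0"
  shows "3 \<le> chromatic_number (Cay (group_closure (pm_set n v)) (pm_set n v))"
proof -
  let ?S = "pm_set n v"
  have v3: "v 3 = - (v 1 + v 2)" using sum by (metis add.inverse_unique)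
  have mem: "v i \<in> ?S" "- v i \<in> ?S" if "i \<in> {1, 2, 3}" for i
    using that n by (auto simp: pm_set_def)
  have S: "v 1 \<in> ?S" "- v 1 \<in> ?S" "v 2 \<in> ?S" "- v 2 \<in> ?S" "v 1 + v 2 \<in> ?S" "- (v 1 + v 2) \<in> ?S"
    using mem[of 1] mem[of 2] mem[of 3] by (simp_all add: v3 add.commute)
  have "0 \<in> group_closure ?S" "v 1 \<in> group_closure ?S" "v 1 + v 2 \<in> group_closure ?S"
    using S by (auto intro: group_closure.base)
  then have "enat (card {0, v 1, v 1 + v 2}) \<le> chromatic_number (Cay (group_closure ?S) ?S)"
    using S by (intro chromatic_number_ge_clique) (auto simp: Cay_def algebra_simps)
  moreover have "v 1 + v 2 \<noteq> 0" using nz(3) sum by (metis add_0)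
  then have "card {0, v 1, v 1 + v 2} = 3"
    using nz by (auto simp: card_insert_if)
  ultimately show ?thesis by (simp only: numeral_eq_enat)
qed

lemma ex_unit_triangle:
  obtains v :: "nat \<Rightarrow> real^2" where "\<And>i. norm (v i) = 1" "v 1 + v 2 + v 3 = 0"
proof -
  define v :: "nat \<Rightarrow> real^2" where
    \<comment> \<open>The cube roots of unity as plane vectors. The default \<open>(1, 0)\<close>
      keeps all other indices at unit norm, so that one \<open>v\<close> is the witness for all four
      values of \<open>n\<close>.\<close>
    "v i = (if i = 2 then vector [-1/2, sqrt 3 / 2] else if i = 3 then vector [-1/2, - sqrt 3 / 2] else vector [1, 0])" for i
  have "norm (v i) = 1" for i
    by (simp add: v_def norm_vec_def L2_set_def sum_2 power_divide)
  moreover have "v 1 + v 2 + v 3 = 0"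
    by (simp add: v_def vec_eq_iff forall_2)
  ultimately show thesis by (rule that)
qed

theorem corollary1p1:
  shows "chi_max 1 = 2 \<and> chi_max 2 = 2 \<and> chi_max 3 = 3 \<and> chi_max 4 = 3"
proof -
  obtain v :: "nat \<Rightarrow> real^2" where v: "\<And>i. norm (v i) = 1" "v 1 + v 2 + v 3 = 0"
    by (rule ex_unit_triangle) (rule that)
  have nz: "v i \<noteq> 0" for i using v(1)[of i] by auto
  have "chi_max n = 2" if "1 \<le> n" "n \<le> 2" for n
    using that v(1) nz by (intro chi_max_eqI[where v = v] chromatic_number_le_2 chromatic_number_ge_2) auto
  moreover have "chi_max n = 3" if "3 \<le> n" "n \<le> 4" for n
    using that v nz by (intro chi_max_eqI[where v = v] chromatic_number_le_3 chromatic_number_ge_3) auto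
  ultimately show ?thesis by simp
qed

end
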